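(* Let $\mathcal{R}$ be a commutative ring with unity, $k\in\mathbb{N}$, and let $\mathcal{I}_1,\ldots,\mathcal{I}_{2k}$ be mutually co-maximal ideals of $\mathcal{R}$ such that either $\mathcal{I}=\prod_{i=1}^{2k}\mathcal{I}_i$ satisfies the unital set condition (USC) or $\mathcal{I}=\mathcal{R}$. Let $m^i_j\in\mathbb{N}$ for $1\le i,j\le 2k$. Then the map \[SP_{2k}(\mathcal{R})\longrightarrow\prod_{i=1}^{2k}\mathbb{PF}^{2k-1,(m^i_1,\ldots,m^i_{2k})}_{\mathcal{I}_i},\qquad [a_{i,j}]_{1\le i,j\le 2k}\mapsto\big([a_{1,1}:\cdots:a_{1,2k}],\ldots,[a_{2k,1}:\cdots:a_{2k,2k}]\big)\] is surjective.
   Context: $SP_{2k}(\mathcal{R})=\{A\in M_{2k\times2k}(\mathcal{R})\mid A^tJA=J\}$ with $J=\begin{pmatrix}0&I_k\\-I_k&0\end{pmatrix}$. For $n\in\mathbb{N}$, $\mathcal{GCD}_{n+1}(\mathcal{R})=\{(a_0,\ldots,a_n)\in\mathcal{R}^{n+1}\mid\sum_i\langle a_i\rangle=\mathcal{R}\}$. For an ideal $\mathcal{J}\subsetneq\mathcal{R}$ and exponents $m_0,\ldots,m_n\in\mathbb{N}$, two tuples are equivalent if there is $\lambda\in\mathcal{R}$ with image a unit in $\mathcal{R}/\mathcal{J}$ such that $a_i\equiv\lambda^{m_i}b_i\bmod\mathcal{J}$ for all $i$; $\mathbb{PF}^{n,(m_0,\ldots,m_n)}_{\mathcal{J}}$ is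 the set of classes, written $[a_0:\cdots:a_n]$. If $\mathcal{J}=\mathcal{R}$ all tuples are equivalent (a singleton). A finite subset of $\mathcal{R}$ is unital if it generates the unit ideal. An ideal $\mathcal{J}\subsetneq\mathcal{R}$ satisfies the USC if for every $n\ge2$ and every unital set $\{a_1,\ldots,a_n\}$ there exists $b\in\langle a_2,\ldots,a_n\rangle$ with $a_1+b$ a unit modulo $\mathcal{J}$. *)

theory Defs
  imports "HOL-Algebra.QuotRing" "HOL-Algebra.Ideal_Product" "HOL-Library.FuncSet"
begin

text \<open>
  Matrix and tuple indices are shifted to start at 0: a tuple of length \<open>n\<close> over \<open>R\<close> is an element of
  \<open>{..<n} \<rightarrow>\<^sub>E carrier R\<close>, and an \<open>n \<times> n\<close> matrix is the tuple of its rows.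
\<close>

definition sq_mats :: "('a, 'b) ring_scheme \<Rightarrow> nat \<Rightarrow> (nat \<Rightarrow> nat \<Rightarrow> 'a) set" where
  "sq_mats R n = ({..<n} \<rightarrow>\<^sub>E ({..<n} \<rightarrow>\<^sub>E carrier R))"

definition mat_times ::
    "('a, 'b) ring_scheme \<Rightarrow> nat \<Rightarrow> (nat \<Rightarrow> nat \<Rightarrow> 'a) \<Rightarrow> (nat \<Rightarrow> nat \<Rightarrow> 'a) \<Rightarrow> nat \<Rightarrow> nat \<Rightarrow> 'a" where
  "mat_times R n A B =
     (\<lambda>i\<in>{..<n}. \<lambda>j\<in>{..<n}. \<Oplus>\<^bsub>R\<^esub>l\<in>{..<n}. A i l \<otimes>\<^bsub>R\<^esub> B l j)"

definition mat_transpose :: "nat \<Rightarrow> (nat \<Rightarrow> nat \<Rightarrow> 'a) \<Rightarrow> nat \<Rightarrow> nat \<Rightarrow> 'a" where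
  "mat_transpose n A = (\<lambda>i\<in>{..<n}. \<lambda>j\<in>{..<n}. A j i)"

definition symp_J :: "('a, 'b) ring_scheme \<Rightarrow> nat \<Rightarrow> nat \<Rightarrow> nat \<Rightarrow> 'a" where
  "symp_J R k =
     (\<lambda>i\<in>{..<2*k}. \<lambda>j\<in>{..<2*k}.
        if j = i + k then \<one>\<^bsub>R\<^esub> else if i = j + k then \<ominus>\<^bsub>R\<^esub> \<one>\<^bsub>R\<^esub> else \<zero>\<^bsub>R\<^esub>)"

definition SP :: "('a, 'b) ring_scheme \<Rightarrow> nat \<Rightarrow> (nat \<Rightarrow> nat \<Rightarrow> 'a) set" where
  "SP R k = {A \<in> sq_mats R (2*k).
     mat_times R (2*k) (mat_times R (2*k) (mat_transpose (2*k) A) (symp_J R k)) A = symp_J R k}"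

text \<open>The sum over \<open>ideals_set R\<close> is the sum of ideals. The argument \<open>N\<close> is the length of the tuple.\<close>

definition GCD_tuples :: "('a, 'b) ring_scheme \<Rightarrow> nat \<Rightarrow> (nat \<Rightarrow> 'a) set" where
  "GCD_tuples R N = {a \<in> {..<N} \<rightarrow>\<^sub>E carrier R.
     (\<Oplus>\<^bsub>ideals_set R\<^esub>i\<in>{..<N}. PIdl\<^bsub>R\<^esub> (a i)) = carrier R}"

definition unit_mod :: "('a, 'b) ring_scheme \<Rightarrow> 'a set \<Rightarrow> 'a \<Rightarrow> bool" where
  "unit_mod R J x \<longleftrightarrow> x \<in> carrier R \<and> J +>\<^bsub>R\<^esub> x \<in> Units (R Quot J)"

definition PF_rel ::
    "('a, 'b) ring_scheme \<Rightarrow> 'a set \<Rightarrow> nat \<Rightarrow> (nat \<Rightarrow> nat) \<Rightarrow> ((nat \<Rightarrow> 'a) \<times> (nat \<Rightarrow> 'a)) set" where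
  "PF_rel R J n m = {(a, b). a \<in> GCD_tuples R (Suc n) \<and> b \<in> GCD_tuples R (Suc n) \<and>
     (J = carrier R \<or>
      (\<exists>c. unit_mod R J c \<and>
           (\<forall>i\<le>n. a i \<ominus>\<^bsub>R\<^esub> (c [^]\<^bsub>R\<^esub> m i) \<otimes>\<^bsub>R\<^esub> b i \<in> J)))}"

definition PF ::
    "('a, 'b) ring_scheme \<Rightarrow> 'a set \<Rightarrow> nat \<Rightarrow> (nat \<Rightarrow> nat) \<Rightarrow> (nat \<Rightarrow> 'a) set set" where
  "PF R J n m = GCD_tuples R (Suc n) // PF_rel R J n m"

definition PF_class ::
    "('a, 'b) ring_scheme \<Rightarrow> 'a set \<Rightarrow> nat \<Rightarrow> (nat \<Rightarrow> nat) \<Rightarrow> (nat \<Rightarrow> 'a) \<Rightarrow> (nat \<Rightarrow> 'a) set" where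
  "PF_class R J n m a = PF_rel R J n m `` {a}"

definition unital :: "('a, 'b) ring_scheme \<Rightarrow> 'a set \<Rightarrow> bool" where
  "unital R S \<longleftrightarrow> finite S \<and> S \<subseteq> carrier R \<and> Idl\<^bsub>R\<^esub> S = carrier R"

definition USC :: "('a, 'b) ring_scheme \<Rightarrow> 'a set \<Rightarrow> bool" where
  "USC R J \<longleftrightarrow> ideal J R \<and> J \<noteq> carrier R \<and>
     (\<forall>n\<ge>2. \<forall>a::nat \<Rightarrow> 'a. unital R (a ` {1..n}) \<longrightarrow>
        (\<exists>b\<in>Idl\<^bsub>R\<^esub> (a ` {2..n}). unit_mod R J (a 1 \<oplus>\<^bsub>R\<^esub> b)))"

definition SP_rows ::
    "('a, 'b) ring_scheme \<Rightarrow> nat \<Rightarrow> (nat \<Rightarrow> 'a set) \<Rightarrow> (nat \<Rightarrow> nat \<Rightarrow> nat) \<Rightarrow>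
     (nat \<Rightarrow> nat \<Rightarrow> 'a) \<Rightarrow> nat \<Rightarrow> (nat \<Rightarrow> 'a) set" where
  "SP_rows R k I m A = (\<lambda>i\<in>{..<2*k}. PF_class R (I i) (2*k - 1) (m i) (A i))"

lemma (in cring) equiv_PF_rel:
  assumes J: "ideal J R"
  shows "equiv (GCD_tuples R (Suc n)) (PF_rel R J n m)"
proof -
  interpret J: ideal J R by fact
  interpret Q: cring "R Quot J" using J.quotient_is_cring is_cring by blast
  have cong: "x \<ominus> y \<in> J \<longleftrightarrow> J +> x = J +> y" if "x \<in> carrier R" "y \<in> carrier R" for x y
    using quotient_eq_iff_same_a_r_cos[OF J that] by blast
  have hom: "(+>) J \<in> ring_hom R (R Quot J)" by (rule J.rcos_ring_hom)
  interpret h: ring_hom_cring R "R Quot J" "(+>) J"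
    by (unfold_locales) (rule hom)
  let ?h = "\<lambda>x. J +> x"
  have pow: "?h (x [^] e) = ?h x [^]\<^bsub>R Quot J\<^esub> e" if "x \<in> carrier R" for x and e :: nat
    using that by (induction e) auto
  let ?E = "\<lambda>a b. \<exists>c. unit_mod R J c \<and> (\<forall>i\<le>n. a i \<ominus> (c [^] m i) \<otimes> b i \<in> J)"
  have carr: "a i \<in> carrier R" if "a \<in> GCD_tuples R (Suc n)" "i \<le> n" for a i
    using that by (auto simp: GCD_tuples_def PiE_def Pi_def)
  have E: "?E a b \<longleftrightarrow> (\<exists>u\<in>Units (R Quot J). \<forall>i\<le>n. ?h (a i) = u [^]\<^bsub>R Quot J\<^esub> m i \<otimes>\<^bsub>R Quot J\<^esub> ?h (b i))"
    (is "_ \<longleftrightarrow> ?F a b")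
    if ab: "a \<in> GCD_tuples R (Suc n)" "b \<in> GCD_tuples R (Suc n)" for a b
  proof -
    have eq: "a i \<ominus> (c [^] m i) \<otimes> b i \<in> J \<longleftrightarrow>
        ?h (a i) = ?h c [^]\<^bsub>R Quot J\<^esub> m i \<otimes>\<^bsub>R Quot J\<^esub> ?h (b i)"
      if "i \<le> n" "c \<in> carrier R" for i c
      using that carr[OF ab(1)] carr[OF ab(2)] by (simp add: cong pow)
    have sur: "\<exists>c\<in>carrier R. u = ?h c" if "u \<in> Units (R Quot J)" for u
      using Q.Units_closed[OF that] unfolding FactRing_def A_RCOSETS_def' by simp
    show ?thesis
    proof
      assume "?E a b"
      then obtain c where "unit_mod R J c" "\<forall>i\<le>n. a i \<ominus> (c [^] m i) \<otimes> b i \<in> J" by blast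
      thus "?F a b" unfolding unit_mod_def using eq by (intro bexI[of _ "?h c"]) blast+
    next
      assume "?F a b"
      then obtain u where u: "u \<in> Units (R Quot J)"
        "\<forall>i\<le>n. ?h (a i) = u [^]\<^bsub>R Quot J\<^esub> m i \<otimes>\<^bsub>R Quot J\<^esub> ?h (b i)" by blast
      then obtain c where "c \<in> carrier R" "u = ?h c" using sur by blast
      thus "?E a b" unfolding unit_mod_def using eq u by (intro exI[of _ c]) blast
    qed
  qed
  have refl: "?F a a" if "a \<in> GCD_tuples R (Suc n)" for a
    using carr[OF that] by (intro bexI[of _ "\<one>\<^bsub>R Quot J\<^esub>"]) auto
  have sym: "?F b a" if "?F a b" "a \<in> GCD_tuples R (Suc n)" "b \<in> GCD_tuples R (Suc n)" for a b
  proof -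
    from that obtain u where u: "u \<in> Units (R Quot J)"
      "\<And>i. i \<le> n \<Longrightarrow> ?h (a i) = u [^]\<^bsub>R Quot J\<^esub> m i \<otimes>\<^bsub>R Quot J\<^esub> ?h (b i)" by blast
    let ?v = "inv\<^bsub>R Quot J\<^esub> u"
    have "?h (b i) = ?v [^]\<^bsub>R Quot J\<^esub> m i \<otimes>\<^bsub>R Quot J\<^esub> ?h (a i)" if "i \<le> n" for i
    proof -
      have "?v [^]\<^bsub>R Quot J\<^esub> m i \<otimes>\<^bsub>R Quot J\<^esub> u [^]\<^bsub>R Quot J\<^esub> m i = \<one>\<^bsub>R Quot J\<^esub>"
        using u(1) Q.nat_pow_distrib[of ?v u "m i"] by (simp add: Q.Units_closed)
      thus ?thesis using u(1) carr[OF \<open>b \<in> _\<close> that]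
        by (simp add: u(2)[OF that] Q.m_assoc[symmetric] Q.Units_closed)
    qed
    thus ?thesis using u(1) by blast
  qed
  have trans: "?F a c" if "?F a b" "?F b c" "c \<in> GCD_tuples R (Suc n)" for a b c
  proof -
    from that obtain u v where u: "u \<in> Units (R Quot J)"
      "\<And>i. i \<le> n \<Longrightarrow> ?h (a i) = u [^]\<^bsub>R Quot J\<^esub> m i \<otimes>\<^bsub>R Quot J\<^esub> ?h (b i)"
      and v: "v \<in> Units (R Quot J)"
      "\<And>i. i \<le> n \<Longrightarrow> ?h (b i) = v [^]\<^bsub>R Quot J\<^esub> m i \<otimes>\<^bsub>R Quot J\<^esub> ?h (c i)" by blast
    show ?thesis using u(1) v(1) carr[OF that(3)]
      by (intro bexI[of _ "u \<otimes>\<^bsub>R Quot J\<^esub> v"])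
        (auto simp: u(2) v(2) Q.nat_pow_distrib Q.m_assoc Q.Units_closed)
  qed
  have rel: "(a, b) \<in> PF_rel R J n m \<longleftrightarrow> a \<in> GCD_tuples R (Suc n) \<and> b \<in> GCD_tuples R (Suc n) \<and>
      (J = carrier R \<or> ?F a b)" for a b
    using E[of a b] unfolding PF_rel_def by blast
  show ?thesis
  proof (rule equivI)
    show "PF_rel R J n m \<subseteq> GCD_tuples R (Suc n) \<times> GCD_tuples R (Suc n)"
      by (auto simp: PF_rel_def)
    show "refl_on (GCD_tuples R (Suc n)) (PF_rel R J n m)"
      unfolding refl_on_def rel using refl by blast
    show "sym (PF_rel R J n m)"
      unfolding sym_def rel using sym by blast
    show "trans (PF_rel R J n m)"
      unfolding trans_def rel using trans by blast
  qed
qed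

end

theory Submission
  imports Defs "HOL-Algebra.Ring_Divisibility"
begin

text \<open>
  Surjectivity already holds with all the scalars \<open>\<lambda>\<close> equal to 1. For the standard symplectic form, the
  transvection \<open>x \<mapsto> x + c \<langle>x, w - v\<rangle> (w - v)\<close> with \<open>c = 1 / \<langle>v, w\<rangle>\<close> sends \<open>v\<close> to \<open>w\<close>, so it suffices to
  join the \<open>n\<close>-th unit vector to the prescribed row \<open>a\<close>, modulo the \<open>n\<close>-th ideal, through a vector \<open>z\<close> that
  pairs to a unit with both. The first pairing is a unit if the coordinate of \<open>z\<close> dual to \<open>n\<close> is 1, and
  the USC provides the remaining coordinates making \<open>\<langle>z, a\<rangle>\<close> a unit. Multiplying \<open>c\<close> by an element that is
  1 modulo the \<open>n\<close>-th ideal and 0 modulo the others leaves the remaining rows unchanged modulo their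
  ideals, so the rows of the identity matrix can be moved one after the other.
\<close>

section \<open>Congruences modulo ideals and maximal ideals\<close>

lemma (in ideal) finsum_in_ideal:
  assumes "f \<in> S \<rightarrow> I"
  shows "(\<Oplus>s\<in>S. f s) \<in> I"
  using assms
proof (induction S rule: infinite_finite_induct)
  case (insert s S)
  then show ?case by (subst finsum_insert) (auto intro: Icarr)
qed auto

lemma (in ideal) diff_trans:
  assumes "x \<ominus> y \<in> I" "y \<ominus> z \<in> I" "x \<in> carrier R" "y \<in> carrier R" "z \<in> carrier R"
  shows "x \<ominus> z \<in> I"
proof -
  have "x \<ominus> z = (x \<ominus> y) \<oplus> (y \<ominus> z)" using assms(3-5) by algebra
  then show ?thesis using assms by simp
qed

text \<open>Zorn's lemma on the ideals above \<open>J\<close> that avoid \<open>\<one>\<close>, a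
  property inherited by unions of chains. It lets \<open>SP_row_unimodular\<close> argue over a
  residue field.\<close>

lemma (in ring) proper_ideal_subset_maximalideal:
  assumes "ideal J R" "\<one> \<notin> J"
  obtains M where "maximalideal M R" "J \<subseteq> M"
proof -
  let ?P = "{K. ideal K R \<and> J \<subseteq> K \<and> \<one> \<notin> K}"
  have "\<exists>M\<in>?P. \<forall>K\<in>?P. M \<subseteq> K \<longrightarrow> K = M"
  proof (rule subset_Zorn)
    fix C assume C: "subset.chain ?P C"
    show "\<exists>U\<in>?P. \<forall>K\<in>C. K \<subseteq> U"
    \<comment> \<open>The union of the empty chain is empty, hence no ideal, so \<open>J\<close>
      itself serves as the upper bound there.\<close>
    proof (cases "C = {}")
      case True
      then show ?thesis using assms by auto
    next
      case False
      have "subset.chain {K. ideal K R} C"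
        using C by (auto simp: pred_on.chain_def)
      then have "ideal (\<Union>C) R"
        using chain_Union_is_ideal[of C] False by simp
      moreover have "J \<subseteq> \<Union>C" "\<one> \<notin> \<Union>C"
        using C False by (fastforce simp: pred_on.chain_def)+
      ultimately show ?thesis by (intro bexI[of _ "\<Union>C"]) auto
    qed
  qed
  then obtain M where M: "M \<in> ?P" "\<forall>K\<in>?P. M \<subseteq> K \<longrightarrow> K = M" by (elim bexE)
  have "maximalideal M R"
  proof (rule maximalidealI)
    show "ideal M R" "carrier R \<noteq> M" using M(1) by auto
    fix K assume K: "ideal K R" "M \<subseteq> K" "K \<subseteq> carrier R"
    show "K = M \<or> K = carrier R"
    proof (cases "\<one> \<in> K")
      case True
      then show ?thesis using ideal.one_imp_carrier[OF K(1)] by simp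
    next
      case False
      then show ?thesis using M K by auto
    qed
  qed
  then show ?thesis using that M(1) by auto
qed

section \<open>Ideals generated by finite families\<close>

definition (in ring) lincombs :: "('c \<Rightarrow> 'a) \<Rightarrow> 'c set \<Rightarrow> 'a set" where
  "lincombs a S = {\<Oplus>s\<in>S. y s \<otimes> a s | y. y \<in> S \<rightarrow> carrier R}"

context cring
begin

lemma lincombs_insert:
  assumes "finite S" "s \<notin> S" "a \<in> insert s S \<rightarrow> carrier R"
  shows "lincombs a (insert s S) = PIdl (a s) <+>\<^bsub>R\<^esub> lincombs a S"
proof (intro equalityI subsetI)
  fix x assume "x \<in> lincombs a (insert s S)"
  then obtain y where y: "y \<in> insert s S \<rightarrow> carrier R" "x = (\<Oplus>t\<in>insert s S. y t \<otimes> a t)"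
    unfolding lincombs_def by blast
  have "x = y s \<otimes> a s \<oplus> (\<Oplus>t\<in>S. y t \<otimes> a t)"
    unfolding y(2) using assms y(1) by (subst finsum_insert) auto
  moreover have "y s \<otimes> a s \<in> PIdl (a s)" using y(1) by (auto simp: cgenideal_def)
  moreover have "(\<Oplus>t\<in>S. y t \<otimes> a t) \<in> lincombs a S" using y(1) by (auto simp: lincombs_def)
  ultimately show "x \<in> PIdl (a s) <+>\<^bsub>R\<^esub> lincombs a S" by (auto simp: set_add_def')
next
  fix x assume "x \<in> PIdl (a s) <+>\<^bsub>R\<^esub> lincombs a S"
  then obtain c y where y: "c \<in> carrier R" "y \<in> S \<rightarrow> carrier R"
    "x = c \<otimes> a s \<oplus> (\<Oplus>t\<in>S. y t \<otimes> a t)"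
    by (auto simp: set_add_def' cgenideal_def lincombs_def)
  have "(\<Oplus>t\<in>insert s S. (y(s := c)) t \<otimes> a t)
      = (y(s := c)) s \<otimes> a s \<oplus> (\<Oplus>t\<in>S. (y(s := c)) t \<otimes> a t)"
    using assms y(1,2) by (subst finsum_insert) (auto simp: Pi_iff)
  also have "(\<Oplus>t\<in>S. (y(s := c)) t \<otimes> a t) = (\<Oplus>t\<in>S. y t \<otimes> a t)"
    using assms y(1,2) by (intro finsum_cong') (auto simp: Pi_iff)
  finally show "x \<in> lincombs a (insert s S)"
    using y unfolding lincombs_def by (auto intro!: exI[of _ "y(s := c)"])
qed

text \<open>Together with \<open>genideal_image_eq_lincombs\<close> this reconciles two encodings of
  the same ideal: the sum of principal ideals in \<open>GCD_tuples\<close> and the generated ideal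
  in \<open>unital\<close>. The explicit coefficients are what the symplectic form is later paired
  with.\<close>

lemma finsum_PIdl_eq_lincombs:
  assumes "finite S" "a \<in> S \<rightarrow> carrier R"
  shows "(\<Oplus>\<^bsub>ideals_set R\<^esub>s\<in>S. PIdl (a s)) = lincombs a S"
proof -
  interpret IS: semiring "ideals_set R" by (rule ideals_set_is_semiring)
  show ?thesis using assms
  proof (induction S)
    case empty
    show ?case unfolding IS.finsum_empty by (auto simp: lincombs_def ideals_set_def)
  next
    case (insert s S)
    have "(\<Oplus>\<^bsub>ideals_set R\<^esub>s\<in>insert s S. PIdl (a s))
      = PIdl (a s) \<oplus>\<^bsub>ideals_set R\<^esub> (\<Oplus>\<^bsub>ideals_set R\<^esub>s\<in>S. PIdl (a s))"
      using insert.hyps insert.prems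
      by (subst IS.finsum_insert) (auto simp: ideals_set_def Pi_iff intro!: cgenideal_ideal)
    also have "\<dots> = PIdl (a s) <+>\<^bsub>R\<^esub> lincombs a S"
      using insert by (simp add: ideals_set_def)
    finally show ?case
      using lincombs_insert[OF insert.hyps insert.prems] by simp
  qed
qed

text \<open>Closure of sums in the semiring of ideals replaces a direct check of the ideal
  axioms.\<close>

lemma lincombs_ideal:
  assumes "finite S" "a \<in> S \<rightarrow> carrier R"
  shows "ideal (lincombs a S) R"
proof -
  interpret IS: semiring "ideals_set R" by (rule ideals_set_is_semiring)
  have "(\<Oplus>\<^bsub>ideals_set R\<^esub>s\<in>S. PIdl (a s)) \<in> carrier (ideals_set R)"
    using assms by (intro IS.finsum_closed) (auto simp: ideals_set_def Pi_iff intro!: cgenideal_ideal)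
  then show ?thesis using finsum_PIdl_eq_lincombs[OF assms] by (simp add: ideals_set_def)
qed

lemma generator_in_lincombs:
  assumes "finite S" "a \<in> S \<rightarrow> carrier R" "s \<in> S"
  shows "a s \<in> lincombs a S"
proof -
  have "(\<Oplus>t\<in>S. (if t = s then \<one> else \<zero>) \<otimes> a t) = (\<Oplus>t\<in>S. if s = t then a t else \<zero>)"
    using assms by (intro finsum_cong') (auto simp: Pi_iff)
  also have "\<dots> = a s" using assms by (intro finsum_singleton) auto
  finally show ?thesis unfolding lincombs_def
    by (auto intro!: exI[of _ "\<lambda>t. if t = s then \<one> else \<zero>"])
qed

lemma genideal_image_eq_lincombs:
  assumes "finite S" "a \<in> S \<rightarrow> carrier R"
  shows "Idl (a ` S) = lincombs a S"
proof
  show "Idl (a ` S) \<subseteq> lincombs a S"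
    using lincombs_ideal[OF assms] generator_in_lincombs[OF assms] by (intro genideal_minimal) auto
  have sub: "a ` S \<subseteq> carrier R" using assms by auto
  interpret G: ideal "Idl (a ` S)" R by (rule genideal_ideal[OF sub])
  show "lincombs a S \<subseteq> Idl (a ` S)"
    using genideal_self[OF sub]
    by (auto simp: lincombs_def intro!: G.finsum_in_ideal G.I_l_closed)
qed

lemma lincombs_eq_carrier_iff:
  assumes "finite S" "a \<in> S \<rightarrow> carrier R"
  shows "lincombs a S = carrier R \<longleftrightarrow> \<one> \<in> lincombs a S"
  using ideal.one_imp_carrier[OF lincombs_ideal[OF assms]] one_closed by metis

lemma GCD_tuples_iff:
  "a \<in> GCD_tuples R N \<longleftrightarrow> a \<in> {..<N} \<rightarrow>\<^sub>E carrier R \<and> \<one> \<in> lincombs a {..<N}"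
proof (cases "a \<in> {..<N} \<rightarrow>\<^sub>E carrier R")
  case True
  then have "a \<in> {..<N} \<rightarrow> carrier R" by (simp add: PiE_def)
  then show ?thesis
    using True finsum_PIdl_eq_lincombs[of "{..<N}" a] lincombs_eq_carrier_iff[of "{..<N}" a]
    unfolding GCD_tuples_def by simp
qed (simp add: GCD_tuples_def)

section \<open>Units modulo an ideal, the unital set condition and co-maximality\<close>

text \<open>A representative of the inverse class turns invertibility into a congruence in
  \<open>R\<close>, which passes to larger ideals by mere inclusion.\<close>

lemma unit_mod_inverse:
  assumes "ideal J R" "unit_mod R J x"
  obtains s where "s \<in> carrier R" "x \<otimes> s \<ominus> \<one> \<in> J"
proof -
  interpret J: ideal J R by fact
  have x: "x \<in> carrier R" and "J +> x \<in> Units (R Quot J)"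
    using assms(2) by (auto simp: unit_mod_def)
  then obtain v where v: "v \<in> carrier (R Quot J)" "(J +> x) \<otimes>\<^bsub>R Quot J\<^esub> v = \<one>\<^bsub>R Quot J\<^esub>"
    unfolding Units_def by auto
  then obtain s where s: "s \<in> carrier R" "v = J +> s"
    unfolding FactRing_def A_RCOSETS_def' by auto
  have "J +> (x \<otimes> s) = J +> \<one>"
    using v(2) s x by (simp add: FactRing_def J.rcoset_mult_add)
  then show ?thesis
    using that[OF s(1)] quotient_eq_iff_same_a_r_cos[OF assms(1), of "x \<otimes> s" \<one>] x s by simp
qed

text \<open>The USC perturbs the first generator by a combination of the others. With
  \<open>b p\<close> placed first, the coefficients of that combination are the entries of
  \<open>z\<close> away from \<open>p\<close>. If \<open>J\<close> is the whole ring, the congruence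
  is vacuous and any \<open>z\<close> will do.\<close>

lemma unital_set_condition_lincomb:
  assumes J: "USC R J \<or> J = carrier R" and n: "(n::nat) \<ge> 2" and p: "p < n"
    and b: "b \<in> {..<n} \<rightarrow> carrier R" "\<one> \<in> lincombs b {..<n}"
  obtains z s where "z \<in> {..<n} \<rightarrow> carrier R" "z p = \<one>" "s \<in> carrier R"
    "(\<Oplus>l\<in>{..<n}. z l \<otimes> b l) \<otimes> s \<ominus> \<one> \<in> J"
proof (cases "J = carrier R")
  case True
  have "(\<Oplus>l\<in>{..<n}. \<one> \<otimes> b l) \<otimes> \<one> \<ominus> \<one> \<in> J"
    unfolding True using b by (intro minus_closed m_closed finsum_closed) auto
  then show ?thesis by (intro that[of "\<lambda>_. \<one>" \<one>]) auto
next
  case False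
  then have usc: "USC R J" using J by simp
  define S where "S = {..<n} - {p}"
  \<comment> \<open>After \<open>b p\<close> in position 1, positions \<open>2..n\<close> list the
    other entries in order: the index shift is 2 before \<open>p\<close> and 1 after it.\<close>
  define a where "a i = (if i = 1 then b p else if i - 2 < p then b (i - 2) else b (i - 1))" for i :: nat
  have a1: "a 1 = b p" by (simp add: a_def)
  have a2: "a ` {2..n} = b ` S"
  proof (intro equalityI subsetI)
    fix x assume "x \<in> a ` {2..n}"
    then obtain i where i: "2 \<le> i" "i \<le> n" "x = a i" by auto
    show "x \<in> b ` S"
    proof (cases "i - 2 < p")
      case True
      then show ?thesis using i by (intro image_eqI[of _ _ "i - 2"]) (auto simp: a_def S_def)
    next
      case False
      then show ?thesis using i by (intro image_eqI[of _ _ "i - 1"]) (auto simp: a_def S_def)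
    qed
  next
    fix x assume "x \<in> b ` S"
    then obtain l where l: "l < n" "l \<noteq> p" "x = b l" by (auto simp: S_def)
    show "x \<in> a ` {2..n}"
    proof (cases "l < p")
      case True
      then show ?thesis using l p by (intro image_eqI[of _ _ "l + 2"]) (auto simp: a_def)
    next
      case False
      then show ?thesis using l p by (intro image_eqI[of _ _ "l + 1"]) (auto simp: a_def)
    qed
  qed
  have "{1..n} = insert 1 {2..n}" using n by auto
  moreover have "insert p S = {..<n}" using p by (auto simp: S_def)
  ultimately have "a ` {1..n} = b ` {..<n}" using a1 a2 by (metis image_insert)
  moreover have "Idl (b ` {..<n}) = carrier R"
    using b genideal_image_eq_lincombs[of "{..<n}" b] lincombs_eq_carrier_iff[of "{..<n}" b] by simp
  ultimately have "unital R (a ` {1..n})" using b(1) by (auto simp: unital_def)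
  then obtain c where c: "c \<in> Idl (a ` {2..n})" "unit_mod R J (a 1 \<oplus> c)" and J: "ideal J R"
    using usc n unfolding USC_def by blast
  have S: "finite S" "b \<in> S \<rightarrow> carrier R" "p \<notin> S" using b by (auto simp: S_def)
  obtain y where y: "y \<in> S \<rightarrow> carrier R" "c = (\<Oplus>t\<in>S. y t \<otimes> b t)"
    using c(1) genideal_image_eq_lincombs[OF S(1,2)] a2 by (auto simp: lincombs_def)
  obtain s where s: "s \<in> carrier R" "(a 1 \<oplus> c) \<otimes> s \<ominus> \<one> \<in> J"
    using unit_mod_inverse[OF J c(2)] by blast
  \<comment> \<open>\<open>y\<close> is only constrained on \<open>S\<close>, so its value at
    \<open>p\<close> is free to be set.\<close>
  let ?z = "y(p := \<one>)"
  have bp: "b p \<in> carrier R" using b p by auto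
  have "(\<Oplus>l\<in>{..<n}. ?z l \<otimes> b l) = ?z p \<otimes> b p \<oplus> (\<Oplus>l\<in>S. ?z l \<otimes> b l)"
    unfolding \<open>insert p S = {..<n}\<close>[symmetric] using S y(1) bp by (subst finsum_insert) (auto simp: Pi_iff)
  also have "(\<Oplus>l\<in>S. ?z l \<otimes> b l) = c"
    unfolding y(2) using S y(1) by (intro finsum_cong') (auto simp: Pi_iff)
  finally have "(\<Oplus>l\<in>{..<n}. ?z l \<otimes> b l) = a 1 \<oplus> c" using bp a1 by simp
  moreover have "?z \<in> {..<n} \<rightarrow> carrier R" using y(1) by (auto simp: S_def)
  ultimately show ?thesis using s by (intro that[of ?z s]) auto
qed

text \<open>Splitting off the factor \<open>I s\<close> leaves a product of two ideals, which lies
  in their intersection.\<close>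

lemma finprod_ideals_set_subset:
  assumes "finite S" "\<And>s. s \<in> S \<Longrightarrow> ideal (I s) R" "s \<in> S"
  shows "(\<Otimes>\<^bsub>ideals_set R\<^esub>t\<in>S. I t) \<subseteq> I s"
proof -
  interpret IS: comm_monoid "ideals_set R" by (rule ideals_set_is_comm_monoid)
  have I: "I \<in> S \<rightarrow> carrier (ideals_set R)" using assms by (auto simp: ideals_set_def)
  have "ideal (\<Otimes>\<^bsub>ideals_set R\<^esub>t\<in>S - {s}. I t) R"
    using IS.finprod_closed[of I "S - {s}"] I by (auto simp: ideals_set_def)
  then have "I s \<cdot>\<^bsub>R\<^esub> (\<Otimes>\<^bsub>ideals_set R\<^esub>t\<in>S - {s}. I t) \<subseteq> I s"
    using ideal_prod_inter assms(2,3) by blast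
  moreover have "(\<Otimes>\<^bsub>ideals_set R\<^esub>t\<in>insert s (S - {s}). I t)
      = I s \<otimes>\<^bsub>ideals_set R\<^esub> (\<Otimes>\<^bsub>ideals_set R\<^esub>t\<in>S - {s}. I t)"
    using assms I by (subst IS.finprod_insert) auto
  ultimately show ?thesis using assms(3) by (simp add: insert_absorb ideals_set_def)
qed

text \<open>The Chinese remainder argument: if \<open>e\<close> serves \<open>S\<close> and
  \<open>\<one> = x \<oplus> y\<close> with \<open>x\<close> in \<open>J\<close> and
  \<open>y\<close> in \<open>I s\<close>, then \<open>y\<close> is 1 modulo \<open>J\<close>, so
  \<open>y \<otimes> e\<close> also serves \<open>insert s S\<close>.\<close>

lemma comaximal_separating_element:
  assumes "finite S" "ideal J R" "\<And>s. s \<in> S \<Longrightarrow> ideal (I s) R"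
    "\<And>s. s \<in> S \<Longrightarrow> J <+>\<^bsub>R\<^esub> I s = carrier R"
  obtains e where "e \<in> carrier R" "e \<ominus> \<one> \<in> J" "\<And>s. s \<in> S \<Longrightarrow> e \<in> I s"
proof -
  interpret J: ideal J R by fact
  have "\<exists>e\<in>carrier R. e \<ominus> \<one> \<in> J \<and> (\<forall>s\<in>S. e \<in> I s)"
    using assms(1,3,4)
  proof (induction S)
    case empty
    then show ?case by (intro bexI[of _ \<one>]) (auto simp: minus_eq r_neg)
  next
    case (insert s S)
    then obtain e where e: "e \<in> carrier R" "e \<ominus> \<one> \<in> J" "\<forall>s\<in>S. e \<in> I s" by auto
    interpret Is: ideal "I s" R using insert by simp
    have "\<one> \<in> J <+>\<^bsub>R\<^esub> I s" using insert.prems by simp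
    then obtain x y where xy: "x \<in> J" "y \<in> I s" "\<one> = x \<oplus> y" by (auto simp: set_add_def')
    have c: "x \<in> carrier R" "y \<in> carrier R" using xy J.Icarr Is.Icarr by auto
    have "y = \<one> \<ominus> x" unfolding xy(3) using c by algebra
    then have "y \<otimes> e \<ominus> \<one> = (e \<ominus> \<one>) \<oplus> \<ominus> (x \<otimes> e)" using c e(1) by algebra
    moreover have "x \<otimes> e \<in> J" using xy(1) e(1) by (rule J.I_r_closed)
    ultimately have "y \<otimes> e \<ominus> \<one> \<in> J" using e(2) by auto
    moreover have "\<forall>t\<in>insert s S. y \<otimes> e \<in> I t"
      using e c xy insert.prems(1) by (auto intro: Is.I_r_closed ideal.I_l_closed)
    ultimately show ?case using c e by (intro bexI[of _ "y \<otimes> e"]) auto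
  qed
  then show ?thesis using that by blast
qed

end

section \<open>Underdetermined linear systems over a domain\<close>

text \<open>Gaussian elimination by cross-multiplication, hence without division: each induction
  step removes one equation and at most one unknown.\<close>

lemma (in domain) homogeneous_system_nontrivial_solution:
  assumes "finite S" "finite T" "card S < card T"
    "\<And>s t. s \<in> S \<Longrightarrow> t \<in> T \<Longrightarrow> A s t \<in> carrier R"
  shows "\<exists>c\<in>T \<rightarrow> carrier R. (\<exists>t\<in>T. c t \<noteq> \<zero>) \<and> (\<forall>s\<in>S. (\<Oplus>t\<in>T. A s t \<otimes> c t) = \<zero>)"
  using assms
proof (induction S arbitrary: A T)
  case empty
  then have "T \<noteq> {}" by auto
  then show ?case by (intro bexI[of _ "\<lambda>_. \<one>"]) auto
next
  case (insert s S)
  show ?case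
  proof (cases "\<forall>t\<in>T. A s t = \<zero>")
    case True
    obtain c where c: "c \<in> T \<rightarrow> carrier R" "\<exists>t\<in>T. c t \<noteq> \<zero>"
      "\<forall>r\<in>S. (\<Oplus>t\<in>T. A r t \<otimes> c t) = \<zero>"
      using insert.IH[of T A] insert.prems insert.hyps by auto
    have "(\<Oplus>t\<in>T. A s t \<otimes> c t) = (\<Oplus>t\<in>T. \<zero>)"
      using True c(1) by (intro finsum_cong') (auto simp: Pi_iff)
    then show ?thesis using c by (intro bexI[of _ c]) auto
  next
    case False
    then obtain t0 where t0: "t0 \<in> T" "A s t0 \<noteq> \<zero>" by blast
    define U where "U = T - {t0}"
    have U: "finite U" "T = insert t0 U" "t0 \<notin> U" using t0 insert.prems by (auto simp: U_def)
    \<comment> \<open>Equation \<open>r\<close> times the pivot \<open>A s t0\<close>, minus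
      equation \<open>s\<close> times \<open>A r t0\<close>: the unknown \<open>t0\<close> drops
      out.\<close>
    define B where "B r t = A s t0 \<otimes> A r t \<ominus> A r t0 \<otimes> A s t" for r t
    have Ac: "A r t \<in> carrier R" if "r \<in> insert s S" "t \<in> T" for r t using insert.prems that by blast
    have "card S < card U" using insert.prems insert.hyps U by auto
    then obtain c where c: "c \<in> U \<rightarrow> carrier R" "\<exists>t\<in>U. c t \<noteq> \<zero>"
      "\<forall>r\<in>S. (\<Oplus>t\<in>U. B r t \<otimes> c t) = \<zero>"
      using insert.IH[of U B] U(1,2) Ac unfolding B_def by auto
    define g where "g r = (\<Oplus>t\<in>U. A r t \<otimes> c t)" for r
    \<comment> \<open>The reduced solution is scaled by the pivot, so that the value at
      \<open>t0\<close> solving equation \<open>s\<close> exists without division.\<close>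
    define d where "d t = (if t = t0 then \<ominus> g s else A s t0 \<otimes> c t)" for t
    have gc: "g r \<in> carrier R" if "r \<in> insert s S" for r
      unfolding g_def using that c(1) Ac U(2) by (intro finsum_closed) (auto simp: Pi_iff)
    have dc: "d \<in> T \<rightarrow> carrier R" using c(1) gc Ac U(2,3) by (auto simp: d_def Pi_iff)
    \<comment> \<open>The right-hand side vanishes trivially for \<open>r = s\<close>; for
      \<open>r\<close> in \<open>S\<close> it is the reduced equation for \<open>c\<close>.\<close>
    have d: "(\<Oplus>t\<in>T. A r t \<otimes> d t) = A s t0 \<otimes> g r \<ominus> A r t0 \<otimes> g s" if r: "r \<in> insert s S" for r
    proof -
      have "(\<Oplus>t\<in>T. A r t \<otimes> d t) = A r t0 \<otimes> d t0 \<oplus> (\<Oplus>t\<in>U. A r t \<otimes> d t)"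
        unfolding U(2) using U(1,3) dc Ac r unfolding U(2) by (subst finsum_insert) (auto simp: Pi_iff)
      also have "(\<Oplus>t\<in>U. A r t \<otimes> d t) = (\<Oplus>t\<in>U. A s t0 \<otimes> (A r t \<otimes> c t))"
        using U(2,3) c(1) Ac r by (intro finsum_cong') (auto simp: d_def m_lcomm Pi_iff)
      also have "\<dots> = A s t0 \<otimes> g r"
        unfolding g_def using U(1,2) c(1) Ac r by (intro finsum_rdistr[symmetric]) (auto simp: Pi_iff)
      finally have "(\<Oplus>t\<in>T. A r t \<otimes> d t) = A r t0 \<otimes> (\<ominus> g s) \<oplus> A s t0 \<otimes> g r"
        by (simp add: d_def)
      then show ?thesis using gc[OF r] gc[of s] Ac[OF r] Ac[of s] t0(1)
        by (simp add: minus_eq r_minus a_comm)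
    qed
    have "(\<Oplus>t\<in>T. A r t \<otimes> d t) = \<zero>" if r: "r \<in> S" for r
    proof -
      have "\<zero> = (\<Oplus>t\<in>U. B r t \<otimes> c t)" using c(3) r by simp
      also have "\<dots> = (\<Oplus>t\<in>U. A s t0 \<otimes> (A r t \<otimes> c t) \<oplus> (\<ominus> A r t0) \<otimes> (A s t \<otimes> c t))"
      proof (intro finsum_cong')
        fix t assume t: "t \<in> U"
        have "A s t0 \<in> carrier R" "A r t \<in> carrier R" "A r t0 \<in> carrier R" "A s t \<in> carrier R"
          "c t \<in> carrier R" using t r Ac c(1) U(2) by auto
        then show "B r t \<otimes> c t = A s t0 \<otimes> (A r t \<otimes> c t) \<oplus> (\<ominus> A r t0) \<otimes> (A s t \<otimes> c t)"
          unfolding B_def by algebra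
      qed (use r Ac c(1) U(2) in \<open>auto simp: Pi_iff\<close>)
      also have "\<dots> = (\<Oplus>t\<in>U. A s t0 \<otimes> (A r t \<otimes> c t)) \<oplus> (\<Oplus>t\<in>U. (\<ominus> A r t0) \<otimes> (A s t \<otimes> c t))"
        using r Ac c(1) U(2) by (intro finsum_addf) (auto simp: Pi_iff)
      also have "(\<Oplus>t\<in>U. A s t0 \<otimes> (A r t \<otimes> c t)) = A s t0 \<otimes> g r"
        unfolding g_def using U(1,2) c(1) Ac r by (intro finsum_rdistr[symmetric]) (auto simp: Pi_iff)
      also have "(\<Oplus>t\<in>U. (\<ominus> A r t0) \<otimes> (A s t \<otimes> c t)) = (\<ominus> A r t0) \<otimes> g s"
        unfolding g_def using U(1,2) c(1) Ac r by (intro finsum_rdistr[symmetric]) (auto simp: Pi_iff)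
      finally show ?thesis using d[of r] r gc Ac t0 by (simp add: minus_eq l_minus)
    qed
    moreover have "(\<Oplus>t\<in>T. A s t \<otimes> d t) = \<zero>"
      using d[of s] gc Ac t0 by (simp add: minus_eq r_neg)
    moreover have "\<exists>t\<in>T. d t \<noteq> \<zero>"
    proof -
      obtain t where t: "t \<in> U" "c t \<noteq> \<zero>" using c(2) by blast
      then have "d t \<noteq> \<zero>" using t0 Ac[of s t0] c(1) U(3) integral[of "A s t0" "c t"]
        by (auto simp: d_def)
      then show ?thesis using t U by blast
    qed
    ultimately show ?thesis using dc by (intro bexI[of _ d]) auto
  qed
qed

section \<open>The standard symplectic form\<close>

context cring
begin

text \<open>This is the column vector \<open>J x\<close>, as \<open>finsum_symp_J_right\<close>
  confirms. Pairing with \<open>x\<close> is then an ordinary dot product with it.\<close>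

definition symp_dual :: "nat \<Rightarrow> (nat \<Rightarrow> 'a) \<Rightarrow> nat \<Rightarrow> 'a" where
  "symp_dual k x t = (if t < k then x (t + k) else \<ominus> x (t - k))"

text \<open>The value \<open>x^t J y\<close>, grouped by coordinate pairs \<open>l\<close>,
  \<open>l + k\<close>, so that alternation and antisymmetry hold summand by summand.\<close>

definition symp_form :: "nat \<Rightarrow> (nat \<Rightarrow> 'a) \<Rightarrow> (nat \<Rightarrow> 'a) \<Rightarrow> 'a" where
  "symp_form k x y = (\<Oplus>l\<in>{..<k}. x l \<otimes> y (l + k) \<ominus> x (l + k) \<otimes> y l)"

lemma finsum_two_blocks:
  fixes k :: nat
  assumes "f \<in> {..<2*k} \<rightarrow> carrier R"
  shows "(\<Oplus>t\<in>{..<2*k}. f t) = (\<Oplus>l\<in>{..<k}. f l \<oplus> f (l + k))"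
proof -
  have shift: "{..<2*k} = {..<k} \<union> (\<lambda>l. l + k) ` {..<k}"
  proof (intro equalityI subsetI)
    fix t assume t: "t \<in> {..<2*k}"
    show "t \<in> {..<k} \<union> (\<lambda>l. l + k) ` {..<k}"
    proof (cases "t < k")
      case False
      then have "t = (t - k) + k" "t - k < k" using t by auto
      then show ?thesis by blast
    qed simp
  qed auto
  have f: "f l \<in> carrier R" "f (l + k) \<in> carrier R" if "l < k" for l using assms that by auto
  have "(\<Oplus>t\<in>{..<2*k}. f t) = (\<Oplus>l\<in>{..<k}. f l) \<oplus> (\<Oplus>t\<in>(\<lambda>l. l + k) ` {..<k}. f t)"
    unfolding shift using f by (intro finsum_Un_disjoint) auto
  also have "(\<Oplus>t\<in>(\<lambda>l. l + k) ` {..<k}. f t) = (\<Oplus>l\<in>{..<k}. f (l + k))"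
    using f by (intro finsum_reindex) auto
  also have "(\<Oplus>l\<in>{..<k}. f l) \<oplus> (\<Oplus>l\<in>{..<k}. f (l + k)) = (\<Oplus>l\<in>{..<k}. f l \<oplus> f (l + k))"
    using f by (intro finsum_addf[symmetric]) auto
  finally show ?thesis .
qed

lemma symp_dual_closed:
  assumes "x \<in> {..<2*k} \<rightarrow> carrier R"
  shows "symp_dual k x \<in> {..<2*k} \<rightarrow> carrier R"
  using assms by (auto simp: symp_dual_def Pi_iff)

lemma symp_dual_dual:
  assumes "x \<in> {..<2*k} \<rightarrow> carrier R" "t < 2*k"
  shows "symp_dual k (symp_dual k x) t = \<ominus> x t"
  using assms by (auto simp: symp_dual_def Pi_iff)

lemma symp_form_closed:
  assumes "x \<in> {..<2*k} \<rightarrow> carrier R" "y \<in> {..<2*k} \<rightarrow> carrier R"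
  shows "symp_form k x y \<in> carrier R"
  unfolding symp_form_def using assms by (intro finsum_closed) (auto simp: Pi_iff)

lemma symp_form_cong:
  assumes "x \<in> {..<2*k} \<rightarrow> carrier R" "y \<in> {..<2*k} \<rightarrow> carrier R"
    "\<And>t. t < 2*k \<Longrightarrow> x' t = x t" "\<And>t. t < 2*k \<Longrightarrow> y' t = y t"
  shows "symp_form k x' y' = symp_form k x y"
  unfolding symp_form_def using assms by (intro finsum_cong') (auto simp: Pi_iff)

lemma symp_form_eq_dual:
  assumes "x \<in> {..<2*k} \<rightarrow> carrier R" "y \<in> {..<2*k} \<rightarrow> carrier R"
  shows "symp_form k x y = (\<Oplus>t\<in>{..<2*k}. x t \<otimes> symp_dual k y t)"
proof -
  have "(\<Oplus>t\<in>{..<2*k}. x t \<otimes> symp_dual k y t)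
    = (\<Oplus>l\<in>{..<k}. x l \<otimes> symp_dual k y l \<oplus> x (l + k) \<otimes> symp_dual k y (l + k))"
    using assms symp_dual_closed[OF assms(2)] by (intro finsum_two_blocks) (auto simp: Pi_iff)
  also have "\<dots> = symp_form k x y"
    unfolding symp_form_def using assms
    by (intro finsum_cong') (auto simp: Pi_iff symp_dual_def minus_eq r_minus)
  finally show ?thesis by simp
qed

lemma symp_form_self:
  assumes "x \<in> {..<2*k} \<rightarrow> carrier R"
  shows "symp_form k x x = \<zero>"
proof -
  have "symp_form k x x = (\<Oplus>l\<in>{..<k}. \<zero>)"
    unfolding symp_form_def using assms
    by (intro finsum_cong') (auto simp: Pi_iff minus_eq r_neg m_comm)
  then show ?thesis by simp
qed

lemma symp_form_swap:
  assumes "x \<in> {..<2*k} \<rightarrow> carrier R" "y \<in> {..<2*k} \<rightarrow> carrier R"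
  shows "symp_form k y x = \<ominus> symp_form k x y"
proof -
  have "symp_form k y x \<oplus> symp_form k x y
      = (\<Oplus>l\<in>{..<k}. (y l \<otimes> x (l + k) \<ominus> y (l + k) \<otimes> x l) \<oplus> (x l \<otimes> y (l + k) \<ominus> x (l + k) \<otimes> y l))"
    unfolding symp_form_def using assms by (intro finsum_addf[symmetric]) (auto simp: Pi_iff)
  also have "\<dots> = (\<Oplus>l\<in>{..<k}. \<zero>)"
  proof (intro finsum_cong')
    fix l assume "l \<in> {..<k}"
    then have "x l \<in> carrier R" "x (l + k) \<in> carrier R" "y l \<in> carrier R" "y (l + k) \<in> carrier R"
      using assms by (auto simp: Pi_iff)
    then show "(y l \<otimes> x (l + k) \<ominus> y (l + k) \<otimes> x l) \<oplus> (x l \<otimes> y (l + k) \<ominus> x (l + k) \<otimes> y l) = \<zero>"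
      by algebra
  qed auto
  finally show ?thesis using assms by (intro minus_equality[symmetric]) (auto simp: symp_form_closed)
qed

text \<open>Linearity in the left argument is always reached from here through
  \<open>symp_form_swap\<close>.\<close>

lemma symp_form_add_smult_right:
  assumes "x \<in> {..<2*k} \<rightarrow> carrier R" "y \<in> {..<2*k} \<rightarrow> carrier R" "z \<in> {..<2*k} \<rightarrow> carrier R"
    "c \<in> carrier R"
  shows "symp_form k x (\<lambda>t. y t \<oplus> c \<otimes> z t) = symp_form k x y \<oplus> c \<otimes> symp_form k x z"
proof -
  let ?f = "\<lambda>y l. x l \<otimes> y (l + k) \<ominus> x (l + k) \<otimes> y l"
  have f: "?f y l \<in> carrier R" "?f z l \<in> carrier R" if "l < k" for l
    using assms that by (auto simp: Pi_iff)
  have "symp_form k x (\<lambda>t. y t \<oplus> c \<otimes> z t) = (\<Oplus>l\<in>{..<k}. ?f y l \<oplus> c \<otimes> ?f z l)"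
    unfolding symp_form_def
  proof (intro finsum_cong')
    fix l assume "l \<in> {..<k}"
    then have "x l \<in> carrier R" "x (l + k) \<in> carrier R" "y l \<in> carrier R" "y (l + k) \<in> carrier R"
      "z l \<in> carrier R" "z (l + k) \<in> carrier R"
      using assms by (auto simp: Pi_iff)
    then show "x l \<otimes> (y (l + k) \<oplus> c \<otimes> z (l + k)) \<ominus> x (l + k) \<otimes> (y l \<oplus> c \<otimes> z l) = ?f y l \<oplus> c \<otimes> ?f z l"
      using assms(4) by algebra
  qed (use f assms(4) in auto)
  also have "\<dots> = symp_form k x y \<oplus> (\<Oplus>l\<in>{..<k}. c \<otimes> ?f z l)"
    unfolding symp_form_def using f assms(4) by (intro finsum_addf) auto
  also have "(\<Oplus>l\<in>{..<k}. c \<otimes> ?f z l) = c \<otimes> symp_form k x z"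
    unfolding symp_form_def using f assms(4) by (intro finsum_rdistr[symmetric]) auto
  finally show ?thesis .
qed

lemma symp_form_finsum_right:
  assumes "finite S" "x \<in> {..<2*k} \<rightarrow> carrier R"
    "\<And>s t. s \<in> S \<Longrightarrow> t < 2*k \<Longrightarrow> f s t \<in> carrier R" "c \<in> S \<rightarrow> carrier R"
  shows "symp_form k x (\<lambda>t. \<Oplus>s\<in>S. f s t \<otimes> c s) = (\<Oplus>s\<in>S. symp_form k x (f s) \<otimes> c s)"
  using assms(1,3,4)
proof (induction S)
  case empty
  have "symp_form k x (\<lambda>t. \<zero>) = (\<Oplus>l\<in>{..<k}. \<zero>)"
    unfolding symp_form_def using assms(2) by (intro finsum_cong') (auto simp: Pi_iff minus_eq)
  then show ?case by simp
next
  case (insert s S)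
  let ?g = "\<lambda>t. \<Oplus>s\<in>S. f s t \<otimes> c s"
  have f: "f s \<in> {..<2*k} \<rightarrow> carrier R" using insert.prems by auto
  have c: "c s \<in> carrier R" "c \<in> S \<rightarrow> carrier R" using insert.prems by auto
  have g: "?g \<in> {..<2*k} \<rightarrow> carrier R"
    using insert.prems by (intro Pi_I finsum_closed) (auto simp: Pi_iff)
  have "(\<Oplus>r\<in>insert s S. f r t \<otimes> c r) = ?g t \<oplus> c s \<otimes> f s t" if "t < 2*k" for t
  proof -
    have "(\<Oplus>r\<in>insert s S. f r t \<otimes> c r) = f s t \<otimes> c s \<oplus> ?g t"
      using insert.hyps insert.prems that by (subst finsum_insert) (auto simp: Pi_iff)
    then show ?thesis using that insert.prems(1)[of s t] c g by (simp add: a_comm m_comm Pi_iff)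
  qed
  then have "symp_form k x (\<lambda>t. \<Oplus>r\<in>insert s S. f r t \<otimes> c r)
      = symp_form k x (\<lambda>t. ?g t \<oplus> c s \<otimes> f s t)"
    using assms(2) f g c by (intro symp_form_cong) (auto simp: Pi_iff)
  also have "\<dots> = symp_form k x ?g \<oplus> c s \<otimes> symp_form k x (f s)"
    by (rule symp_form_add_smult_right[OF assms(2) g f c(1)])
  also have "symp_form k x ?g = (\<Oplus>s\<in>S. symp_form k x (f s) \<otimes> c s)"
    using insert by auto
  also have "(\<Oplus>s\<in>S. symp_form k x (f s) \<otimes> c s) \<oplus> c s \<otimes> symp_form k x (f s)
      = (\<Oplus>s\<in>insert s S. symp_form k x (f s) \<otimes> c s)"
  proof -
    have cl: "symp_form k x (f r) \<in> carrier R" if "r \<in> insert s S" for r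
      using that insert.prems assms(2) by (intro symp_form_closed) auto
    have "(\<Oplus>s\<in>S. symp_form k x (f s) \<otimes> c s) \<in> carrier R"
      using cl c by (intro finsum_closed) (auto simp: Pi_iff)
    moreover have "(\<Oplus>s\<in>insert s S. symp_form k x (f s) \<otimes> c s)
        = symp_form k x (f s) \<otimes> c s \<oplus> (\<Oplus>s\<in>S. symp_form k x (f s) \<otimes> c s)"
      using insert.hyps cl c by (subst finsum_insert) (auto simp: Pi_iff)
    ultimately show ?thesis using cl[of s] c by (simp add: a_comm m_comm)
  qed
  finally show ?case .
qed

section \<open>Symplectic matrices and transvections\<close>

lemma symp_J_simps:
  assumes "i < 2*k" "j < 2*k"
  shows "symp_J R k i j = (if j = i + k then \<one> else if i = j + k then \<ominus> \<one> else \<zero>)"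
  using assms by (simp add: symp_J_def)

lemma finsum_symp_J_right:
  assumes "c \<in> {..<2*k} \<rightarrow> carrier R" "j < 2*k"
  shows "(\<Oplus>t\<in>{..<2*k}. symp_J R k j t \<otimes> c t) = symp_dual k c j"
proof -
  \<comment> \<open>The only column in which row \<open>j\<close> of \<open>J\<close> is
    nonzero.\<close>
  define j' where "j' = (if j < k then j + k else j - k)"
  have "(\<Oplus>t\<in>{..<2*k}. symp_J R k j t \<otimes> c t)
      = (\<Oplus>t\<in>{..<2*k}. if j' = t then (if j < k then c t else \<ominus> c t) else \<zero>)"
    using assms by (intro finsum_cong') (auto simp: symp_J_simps j'_def Pi_iff l_minus)
  also have "\<dots> = (if j < k then c j' else \<ominus> c j')"
    using assms by (intro finsum_singleton) (auto simp: j'_def Pi_iff)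
  finally show ?thesis by (simp add: symp_dual_def j'_def)
qed

lemma finsum_symp_J_left:
  assumes "c \<in> {..<2*k} \<rightarrow> carrier R" "j < 2*k"
  shows "(\<Oplus>t\<in>{..<2*k}. c t \<otimes> symp_J R k t j) = \<ominus> symp_dual k c j"
proof -
  define j' where "j' = (if j < k then j + k else j - k)"
  have "(\<Oplus>t\<in>{..<2*k}. c t \<otimes> symp_J R k t j)
      = (\<Oplus>t\<in>{..<2*k}. if j' = t then (if j < k then \<ominus> c t else c t) else \<zero>)"
    using assms by (intro finsum_cong') (auto simp: symp_J_simps j'_def Pi_iff r_minus)
  also have "\<dots> = (if j < k then \<ominus> c j' else c j')"
    using assms by (intro finsum_singleton) (auto simp: j'_def Pi_iff)
  finally show ?thesis using assms by (auto simp: symp_dual_def j'_def Pi_iff)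
qed

text \<open>The entry \<open>(i, j)\<close> of \<open>A^t J A\<close> is the pairing of columns
  \<open>i\<close> and \<open>j\<close>. The defining condition thus concerns columns, whereas the
  map of the theorem reads off rows.\<close>

lemma SP_iff:
  "A \<in> SP R k \<longleftrightarrow> A \<in> sq_mats R (2*k) \<and>
     (\<forall>i<2*k. \<forall>j<2*k. symp_form k (\<lambda>r. A r i) (\<lambda>r. A r j) = symp_J R k i j)"
proof (cases "A \<in> sq_mats R (2*k)")
  case True
  let ?P = "mat_times R (2*k) (mat_times R (2*k) (mat_transpose (2*k) A) (symp_J R k)) A"
  have A: "A r i \<in> carrier R" if "r < 2*k" "i < 2*k" for r i
    using True that by (auto simp: sq_mats_def PiE_def Pi_iff)
  have P: "?P i j = symp_form k (\<lambda>r. A r i) (\<lambda>r. A r j)" if ij: "i < 2*k" "j < 2*k" for i j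
  proof -
    have col: "(\<lambda>r. A r i) \<in> {..<2*k} \<rightarrow> carrier R" "(\<lambda>r. A r j) \<in> {..<2*k} \<rightarrow> carrier R"
      using A ij by auto
    have dc: "symp_dual k (\<lambda>r. A r i) l \<in> carrier R" if "l < 2*k" for l
      using symp_dual_closed[OF col(1)] that by auto
    have inner: "(\<Oplus>r\<in>{..<2*k}. mat_transpose (2*k) A i r \<otimes> symp_J R k r l) = \<ominus> symp_dual k (\<lambda>r. A r i) l"
      if l: "l < 2*k" for l
    proof -
      have "(\<Oplus>r\<in>{..<2*k}. mat_transpose (2*k) A i r \<otimes> symp_J R k r l) = (\<Oplus>r\<in>{..<2*k}. A r i \<otimes> symp_J R k r l)"
        using ij l A by (intro finsum_cong') (auto simp: mat_transpose_def symp_J_simps)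
      then show ?thesis using finsum_symp_J_left[OF col(1) l] by simp
    qed
    have "?P i j = (\<Oplus>l\<in>{..<2*k}. mat_times R (2*k) (mat_transpose (2*k) A) (symp_J R k) i l \<otimes> A l j)"
      using ij by (simp add: mat_times_def[of _ _ "mat_times R (2*k) (mat_transpose (2*k) A) (symp_J R k)"])
    \<comment> \<open>Multiplying by \<open>J\<close> from the right produces minus the dual; the
      sign is pulled out and absorbed by swapping the arguments of the form.\<close>
    also have "\<dots> = (\<Oplus>l\<in>{..<2*k}. \<ominus> \<one> \<otimes> (A l j \<otimes> symp_dual k (\<lambda>r. A r i) l))"
    proof (intro finsum_cong')
      fix l assume l: "l \<in> {..<2*k}"
      then have "A l j \<in> carrier R" "symp_dual k (\<lambda>r. A r i) l \<in> carrier R" using A ij dc by auto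
      then have "\<ominus> symp_dual k (\<lambda>r. A r i) l \<otimes> A l j = \<ominus> \<one> \<otimes> (A l j \<otimes> symp_dual k (\<lambda>r. A r i) l)"
        by (simp add: l_minus r_minus m_comm)
      then show "mat_times R (2*k) (mat_transpose (2*k) A) (symp_J R k) i l \<otimes> A l j
          = \<ominus> \<one> \<otimes> (A l j \<otimes> symp_dual k (\<lambda>r. A r i) l)"
        using l ij inner[of l] by (simp add: mat_times_def)
    qed (use A ij dc in auto)
    also have "\<dots> = \<ominus> \<one> \<otimes> symp_form k (\<lambda>r. A r j) (\<lambda>r. A r i)"
      unfolding symp_form_eq_dual[OF col(2,1)] using A ij dc by (intro finsum_rdistr[symmetric]) auto
    also have "\<dots> = symp_form k (\<lambda>r. A r i) (\<lambda>r. A r j)"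
      using symp_form_swap[OF col] symp_form_closed[OF col] by (simp add: l_minus)
    finally show ?thesis .
  qed
  have "?P = symp_J R k \<longleftrightarrow> (\<forall>i<2*k. \<forall>j<2*k. ?P i j = symp_J R k i j)"
    unfolding mat_times_def symp_J_def by (auto simp: fun_eq_iff restrict_def)
  then show ?thesis using True P by (auto simp: SP_def)
qed (simp add: SP_def)

lemma SP_closed:
  assumes "A \<in> SP R k" "i < 2*k" "j < 2*k"
  shows "A i j \<in> carrier R"
  using assms by (auto simp: SP_def sq_mats_def PiE_def Pi_iff)

text \<open>Coordinate \<open>j\<close> of \<open>A^t J A c = J c\<close>. It recovers
  \<open>c\<close> from \<open>A c\<close> up to signs and a permutation, and so stands in for
  invertibility of \<open>A\<close>.\<close>

lemma symp_form_col_mat_vec: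
  assumes "A \<in> SP R k" "c \<in> {..<2*k} \<rightarrow> carrier R" "j < 2*k"
  shows "symp_form k (\<lambda>r. A r j) (\<lambda>r. \<Oplus>t\<in>{..<2*k}. A r t \<otimes> c t) = symp_dual k c j"
proof -
  have A: "A i j \<in> carrier R" if "i < 2*k" "j < 2*k" for i j using assms that SP_closed by simp
  have "symp_form k (\<lambda>r. A r j) (\<lambda>r. \<Oplus>t\<in>{..<2*k}. A r t \<otimes> c t)
      = (\<Oplus>t\<in>{..<2*k}. symp_form k (\<lambda>r. A r j) (\<lambda>r. A r t) \<otimes> c t)"
    using assms A by (intro symp_form_finsum_right[of _ _ _ "\<lambda>t r. A r t"]) auto
  also have "\<dots> = (\<Oplus>t\<in>{..<2*k}. symp_J R k j t \<otimes> c t)"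
    using assms by (intro finsum_cong') (auto simp: SP_iff symp_J_simps Pi_iff)
  finally show ?thesis using finsum_symp_J_right[OF assms(2,3)] by simp
qed

text \<open>The new matrix is \<open>A T\<close> for the symplectic transvection \<open>v T = v \<oplus> c \<otimes> symp_form k v u \<otimes> u\<close>.\<close>

lemma SP_transvection:
  assumes "A \<in> SP R k" "u \<in> {..<2*k} \<rightarrow> carrier R" "c \<in> carrier R"
  shows "(\<lambda>r\<in>{..<2*k}. \<lambda>j\<in>{..<2*k}. A r j \<oplus> c \<otimes> symp_form k (A r) u \<otimes> u j) \<in> SP R k" (is "?B \<in> _")
proof -
  have A: "A i j \<in> carrier R" if "i < 2*k" "j < 2*k" for i j using assms that SP_closed by simp
  have u: "u j \<in> carrier R" if "j < 2*k" for j using assms that by auto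
  \<comment> \<open>In terms of columns the transvection is a rank-one update: column
    \<open>j\<close> of \<open>A\<close> gains the multiple \<open>c \<otimes> u j\<close> of
    \<open>d\<close>.\<close>
  define d where "d r = symp_form k (A r) u" for r
  have dc: "d \<in> {..<2*k} \<rightarrow> carrier R"
    using A assms(2) by (auto simp: d_def intro!: symp_form_closed)
  have col: "(\<lambda>r. A r j) \<in> {..<2*k} \<rightarrow> carrier R" if "j < 2*k" for j using A that by auto
  \<comment> \<open>Here \<open>d = A (J u)\<close>, so pairing it with the columns of
    \<open>A\<close> yields \<open>J (J u) = - u\<close>.\<close>
  have form_d: "symp_form k (\<lambda>r. A r j) d = \<ominus> u j" if j: "j < 2*k" for j
  proof -
    have "symp_form k (\<lambda>r. A r j) d
        = symp_form k (\<lambda>r. A r j) (\<lambda>r. \<Oplus>t\<in>{..<2*k}. A r t \<otimes> symp_dual k u t)"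
      using symp_dual_closed[OF assms(2)] A assms(2) j
      by (intro symp_form_cong) (auto simp: d_def Pi_iff intro!: symp_form_eq_dual finsum_closed)
    then show ?thesis
      using symp_form_col_mat_vec[OF assms(1) symp_dual_closed[OF assms(2)] j] symp_dual_dual[OF assms(2) j]
      by simp
  qed
  have B: "?B r j = A r j \<oplus> (c \<otimes> u j) \<otimes> d r" if "r < 2*k" "j < 2*k" for r j
    using that A u assms(3) dc by (simp add: d_def[symmetric] m_ac Pi_iff)
  have colB: "(\<lambda>r. A r j \<oplus> (c \<otimes> u j) \<otimes> d r) \<in> {..<2*k} \<rightarrow> carrier R" if "j < 2*k" for j
    using that A u assms(3) dc by (auto simp: Pi_iff)
  show ?thesis unfolding SP_iff
  proof (intro conjI allI impI)
    show "?B \<in> sq_mats R (2*k)"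
      using A u assms(3) dc by (auto simp: sq_mats_def d_def[symmetric] Pi_iff)
    fix i j assume i: "i < 2*k" and j: "j < 2*k"
    let ?x = "\<lambda>r. A r i \<oplus> (c \<otimes> u i) \<otimes> d r"
    have "symp_form k (\<lambda>r. ?B r i) (\<lambda>r. ?B r j) = symp_form k ?x (\<lambda>r. A r j \<oplus> (c \<otimes> u j) \<otimes> d r)"
      using colB[OF i] colB[OF j] B i j by (intro symp_form_cong) auto
    also have "\<dots> = symp_form k ?x (\<lambda>r. A r j) \<oplus> (c \<otimes> u j) \<otimes> symp_form k ?x d"
      using colB[OF i] col[OF j] dc u[OF j] assms(3) by (intro symp_form_add_smult_right) auto
    also have "symp_form k ?x (\<lambda>r. A r j) = \<ominus> (symp_form k (\<lambda>r. A r j) (\<lambda>r. A r i) \<oplus> (c \<otimes> u i) \<otimes> symp_form k (\<lambda>r. A r j) d)"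
      using symp_form_swap[OF col[OF j] colB[OF i]] col[OF j] col[OF i] dc u[OF i] assms(3)
      by (simp add: symp_form_add_smult_right)
    also have "symp_form k (\<lambda>r. A r j) (\<lambda>r. A r i) = \<ominus> symp_J R k i j"
      using symp_form_swap[OF col[OF i] col[OF j]] assms(1) i j by (simp add: SP_iff)
    also have "symp_form k ?x d = \<ominus> (symp_form k d (\<lambda>r. A r i) \<oplus> (c \<otimes> u i) \<otimes> symp_form k d d)"
      using symp_form_swap[OF dc colB[OF i]] col[OF i] dc u[OF i] assms(3)
      by (simp add: symp_form_add_smult_right)
    also have "symp_form k d (\<lambda>r. A r i) = u i"
      using symp_form_swap[OF col[OF i] dc] form_d[OF i] u[OF i] by simp
    \<comment> \<open>The quadratic term vanishes because the form is alternating, and the two cross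
      terms cancel.\<close>
    finally have "symp_form k (\<lambda>r. ?B r i) (\<lambda>r. ?B r j)
        = \<ominus> (\<ominus> symp_J R k i j \<oplus> (c \<otimes> u i) \<otimes> (\<ominus> u j)) \<oplus> (c \<otimes> u j) \<otimes> (\<ominus> (u i \<oplus> (c \<otimes> u i) \<otimes> \<zero>))"
      by (simp only: form_d[OF j] symp_form_self[OF dc])
    moreover have "symp_J R k i j \<in> carrier R" using i j by (simp add: symp_J_simps)
    then have "\<ominus> (\<ominus> symp_J R k i j \<oplus> (c \<otimes> u i) \<otimes> (\<ominus> u j)) \<oplus> (c \<otimes> u j) \<otimes> (\<ominus> (u i \<oplus> (c \<otimes> u i) \<otimes> \<zero>))
        = symp_J R k i j"
      using u[OF i] u[OF j] assms(3) by algebra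
    ultimately show "symp_form k (\<lambda>r. ?B r i) (\<lambda>r. ?B r j) = symp_J R k i j" by (simp only:)
  qed
qed

lemma symp_form_ideal:
  assumes "ideal J R" "y \<in> {..<2*k} \<rightarrow> carrier R" "x \<in> {..<2*k} \<rightarrow> J"
  shows "symp_form k y x \<in> J"
proof -
  interpret J: ideal J R by fact
  have "y l \<otimes> x (l + k) \<ominus> y (l + k) \<otimes> x l \<in> J" if "l < k" for l
    using that assms(2,3) by (auto simp: Pi_iff minus_eq intro!: J.a_closed J.a_inv_closed J.I_l_closed)
  then show ?thesis unfolding symp_form_def by (intro J.finsum_in_ideal) auto
qed

lemma symp_form_diff_ideal:
  assumes "ideal J R" "y \<in> {..<2*k} \<rightarrow> carrier R" "x \<in> {..<2*k} \<rightarrow> carrier R"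
    "x' \<in> {..<2*k} \<rightarrow> carrier R" "\<And>t. t < 2*k \<Longrightarrow> x t \<ominus> x' t \<in> J"
  shows "symp_form k y x \<ominus> symp_form k y x' \<in> J"
proof -
  \<comment> \<open>The difference is written with the scalar \<open>\<ominus> \<one>\<close> to
    match \<open>symp_form_add_smult_right\<close>.\<close>
  have "symp_form k y (\<lambda>t. x t \<oplus> (\<ominus> \<one>) \<otimes> x' t) \<in> J"
    using assms by (intro symp_form_ideal) (auto simp: Pi_iff minus_eq l_minus)
  then show ?thesis
    using assms by (simp add: symp_form_add_smult_right symp_form_closed minus_eq l_minus)
qed

lemma symp_form_unit_vector:
  assumes "y \<in> {..<2*k} \<rightarrow> carrier R" "i < 2*k"
  shows "symp_form k (\<lambda>t. if i = t then \<one> else \<zero>) y = symp_dual k y i"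
proof -
  have d: "symp_dual k y \<in> {..<2*k} \<rightarrow> carrier R" using symp_dual_closed assms(1) by blast
  have "symp_form k (\<lambda>t. if i = t then \<one> else \<zero>) y
      = (\<Oplus>t\<in>{..<2*k}. (if i = t then \<one> else \<zero>) \<otimes> symp_dual k y t)"
    using assms by (intro symp_form_eq_dual) auto
  also have "\<dots> = (\<Oplus>t\<in>{..<2*k}. if i = t then symp_dual k y t else \<zero>)"
    using d by (intro finsum_cong') (auto simp: Pi_iff)
  also have "\<dots> = symp_dual k y i"
    using d assms(2) by (intro finsum_singleton) auto
  finally show ?thesis .
qed

lemma SP_one: "(\<lambda>i\<in>{..<2*k}. \<lambda>j\<in>{..<2*k}. if i = j then \<one> else \<zero>) \<in> SP R k" (is "?E \<in> _")
  unfolding SP_iff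
proof (intro conjI allI impI)
  show "?E \<in> sq_mats R (2*k)" by (auto simp: sq_mats_def)
  fix i j assume ij: "i < 2*k" "j < 2*k"
  have "symp_form k (\<lambda>r. ?E r i) (\<lambda>r. ?E r j)
      = symp_form k (\<lambda>t. if i = t then \<one> else \<zero>) (\<lambda>t. if j = t then \<one> else \<zero>)"
    using ij by (intro symp_form_cong) auto
  also have "\<dots> = symp_dual k (\<lambda>t. if j = t then \<one> else \<zero>) i"
    using ij by (intro symp_form_unit_vector) auto
  also have "\<dots> = symp_J R k i j"
    using ij by (auto simp: symp_dual_def symp_J_simps)
  finally show "symp_form k (\<lambda>r. ?E r i) (\<lambda>r. ?E r j) = symp_J R k i j" .
qed

text \<open>If a row were not unimodular, then modulo some maximal ideal \<open>M\<close> the matrix would have a zero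
  row, hence a nonzero kernel vector; but symplecticity recovers every coordinate of a vector \<open>c\<close>
  from \<open>A c\<close>.\<close>

lemma SP_row_unimodular:
  assumes A: "A \<in> SP R k" and i: "i < 2*k"
  shows "\<one> \<in> lincombs (A i) {..<2*k}"
proof (rule ccontr)
  assume "\<one> \<notin> lincombs (A i) {..<2*k}"
  have Ac: "A r t \<in> carrier R" if "r < 2*k" "t < 2*k" for r t using A that SP_closed by simp
  then have row: "A i \<in> {..<2*k} \<rightarrow> carrier R" using i by auto
  obtain M where "maximalideal M R" and sub: "lincombs (A i) {..<2*k} \<subseteq> M"
    using proper_ideal_subset_maximalideal[OF lincombs_ideal[OF _ row]] \<open>\<one> \<notin> _\<close> by auto
  interpret M: maximalideal M R by fact
  interpret F: field "R Quot M" by (rule M.quotient_is_field[OF is_cring])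
  interpret h: ring_hom_cring R "R Quot M" "(+>) M"
    by unfold_locales (rule M.rcos_ring_hom)
  have mem: "M +> x = \<zero>\<^bsub>R Quot M\<^esub> \<longleftrightarrow> x \<in> M" if "x \<in> carrier R" for x
    using that quotient_eq_iff_same_a_r_cos[OF M.is_ideal, of x \<zero>] h.hom_zero by (simp add: minus_eq)
  \<comment> \<open>Row \<open>i\<close> is zero modulo \<open>M\<close>, so only the other rows
    impose equations, one fewer than there are unknowns.\<close>
  have card: "card ({..<2*k} - {i}) < card {..<2*k}" using i by simp
  have "\<exists>c\<in>{..<2*k} \<rightarrow> carrier (R Quot M). (\<exists>t\<in>{..<2*k}. c t \<noteq> \<zero>\<^bsub>R Quot M\<^esub>) \<and>
    (\<forall>s\<in>{..<2*k} - {i}.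
      (\<Oplus>\<^bsub>R Quot M\<^esub>t\<in>{..<2*k}. (M +> A s t) \<otimes>\<^bsub>R Quot M\<^esub> c t) = \<zero>\<^bsub>R Quot M\<^esub>)"
    using Ac by (intro F.homogeneous_system_nontrivial_solution[OF _ _ card]) auto
  then obtain c where c: "c \<in> {..<2*k} \<rightarrow> carrier (R Quot M)" "\<exists>t\<in>{..<2*k}. c t \<noteq> \<zero>\<^bsub>R Quot M\<^esub>"
    and sol: "\<forall>s\<in>{..<2*k} - {i}.
      (\<Oplus>\<^bsub>R Quot M\<^esub>t\<in>{..<2*k}. (M +> A s t) \<otimes>\<^bsub>R Quot M\<^esub> c t) = \<zero>\<^bsub>R Quot M\<^esub>"
    by blast
  have "\<forall>t\<in>{..<2*k}. \<exists>x. x \<in> carrier R \<and> c t = M +> x"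
  proof
    fix t assume "t \<in> {..<2*k}"
    then have "c t \<in> carrier (R Quot M)" using c(1) by (simp add: Pi_iff)
    then show "\<exists>x. x \<in> carrier R \<and> c t = M +> x"
      unfolding FactRing_def A_RCOSETS_def' by auto
  qed
  from bchoice[OF this]
  obtain x where "\<forall>t\<in>{..<2*k}. x t \<in> carrier R \<and> c t = M +> x t" ..
  then have x: "x t \<in> carrier R" "c t = M +> x t" if "t < 2*k" for t using that by simp_all
  have xc: "x \<in> {..<2*k} \<rightarrow> carrier R" using x by auto
  have "(\<Oplus>t\<in>{..<2*k}. A s t \<otimes> x t) \<in> M" if s: "s < 2*k" for s
  proof (cases "s = i")
    case True
    have "A i t \<in> M" if "t < 2*k" for t
      using generator_in_lincombs[OF _ row, of t] sub that by auto
    then show ?thesis using True x by (auto intro!: M.finsum_in_ideal M.I_r_closed)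
  next
    case False
    have "M +> (\<Oplus>t\<in>{..<2*k}. A s t \<otimes> x t)
        = (\<Oplus>\<^bsub>R Quot M\<^esub>t\<in>{..<2*k}. ((+>) M \<circ> (\<lambda>t. A s t \<otimes> x t)) t)"
      using Ac x s by (intro h.hom_finsum) auto
    also have "\<dots> = (\<Oplus>\<^bsub>R Quot M\<^esub>t\<in>{..<2*k}. (M +> A s t) \<otimes>\<^bsub>R Quot M\<^esub> c t)"
      using Ac x s c(1) by (intro F.finsum_cong') auto
    also have "\<dots> = \<zero>\<^bsub>R Quot M\<^esub>" using sol s False by simp
    finally have "M +> (\<Oplus>t\<in>{..<2*k}. A s t \<otimes> x t) = \<zero>\<^bsub>R Quot M\<^esub>" .
    moreover have "(\<Oplus>t\<in>{..<2*k}. A s t \<otimes> x t) \<in> carrier R"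
      using Ac x(1) s by (intro finsum_closed) auto
    ultimately show ?thesis by (simp only: mem)
  qed
  \<comment> \<open>All coordinates of \<open>A x\<close> lie in \<open>M\<close>, hence so do its
    pairings with the columns, which are the coordinates of \<open>x\<close> up to sign.\<close>
  then have "symp_form k (\<lambda>r. A r j) (\<lambda>r. \<Oplus>t\<in>{..<2*k}. A r t \<otimes> x t) \<in> M" if "j < 2*k" for j
    using that Ac by (intro symp_form_ideal[OF M.is_ideal]) auto
  then have dual: "symp_dual k x j \<in> M" if "j < 2*k" for j
    using that symp_form_col_mat_vec[OF A xc] by simp
  have "x t \<in> M" if t: "t < 2*k" for t
  proof (cases "t < k")
    case True
    then have "\<ominus> x t \<in> M" using dual[of "t + k"] by (auto simp: symp_dual_def)
    then have "\<ominus> (\<ominus> x t) \<in> M" by (rule M.a_inv_closed)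
    then show ?thesis using x[OF t] by simp
  next
    case False
    then have "t - k < k" "t - k < 2*k" "t - k + k = t" using t by auto
    then show ?thesis using dual[of "t - k"] by (simp add: symp_dual_def)
  qed
  then show False using c(2) x mem by auto
qed

lemma SP_row_GCD_tuple:
  assumes "A \<in> SP R k" "i < 2*k"
  shows "A i \<in> GCD_tuples R (2*k)"
  using assms SP_row_unimodular[OF assms] by (auto simp: GCD_tuples_iff SP_def sq_mats_def)

text \<open>Dualizing permutes coordinates up to sign, so dualizing the coefficients as well
  preserves the dot product.\<close>

lemma symp_dual_unimodular:
  assumes a: "a \<in> {..<2*k} \<rightarrow> carrier R" "\<one> \<in> lincombs a {..<2*k}"
  shows "\<one> \<in> lincombs (symp_dual k a) {..<2*k}"
proof -
  obtain y where y: "y \<in> {..<2*k} \<rightarrow> carrier R" "\<one> = (\<Oplus>t\<in>{..<2*k}. y t \<otimes> a t)"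
    using a(2) by (auto simp: lincombs_def)
  have d: "symp_dual k a \<in> {..<2*k} \<rightarrow> carrier R" "symp_dual k y \<in> {..<2*k} \<rightarrow> carrier R"
    using symp_dual_closed a(1) y(1) by auto
  have "(\<Oplus>t\<in>{..<2*k}. symp_dual k y t \<otimes> symp_dual k a t)
      = (\<Oplus>l\<in>{..<k}. symp_dual k y l \<otimes> symp_dual k a l \<oplus> symp_dual k y (l + k) \<otimes> symp_dual k a (l + k))"
    using d by (intro finsum_two_blocks) (auto simp: Pi_iff)
  also have "\<dots> = (\<Oplus>l\<in>{..<k}. y l \<otimes> a l \<oplus> y (l + k) \<otimes> a (l + k))"
    using y(1) a(1) by (intro finsum_cong') (auto simp: Pi_iff symp_dual_def l_minus r_minus a_comm)
  also have "\<dots> = \<one>"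
    unfolding y(2) using y(1) a(1) by (intro finsum_two_blocks[symmetric]) (auto simp: Pi_iff)
  finally show ?thesis using d(2) by (auto simp: lincombs_def intro!: exI[of _ "symp_dual k y"])
qed

text \<open>With \<open>u = w - A n\<close>, the transvection along \<open>u\<close> scaled by the inverse of \<open>symp_form k (A n) w\<close>
  sends \<open>A n\<close> to \<open>w\<close>; the factor \<open>e\<close> makes it the identity modulo the other ideals.\<close>

lemma SP_move_row:
  assumes A: "A \<in> SP R k" and n: "n < 2*k" and I: "\<And>i. i < 2*k \<Longrightarrow> ideal (I i) R"
    and e: "e \<in> carrier R" "e \<ominus> \<one> \<in> I n" "\<And>i. i < 2*k \<Longrightarrow> i \<noteq> n \<Longrightarrow> e \<in> I i"
    and v: "v \<in> {..<2*k} \<rightarrow> carrier R" "\<And>j. j < 2*k \<Longrightarrow> A n j \<ominus> v j \<in> I n"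
    and w: "w \<in> {..<2*k} \<rightarrow> carrier R" and s: "s \<in> carrier R" "symp_form k w v \<otimes> s \<ominus> \<one> \<in> I n"
  shows "\<exists>B\<in>SP R k. (\<forall>j<2*k. B n j \<ominus> w j \<in> I n) \<and>
    (\<forall>i<2*k. i \<noteq> n \<longrightarrow> (\<forall>j<2*k. B i j \<ominus> A i j \<in> I i))"
proof -
  interpret In: ideal "I n" R by (rule I[OF n])
  have Ac: "A r t \<in> carrier R" if "r < 2*k" "t < 2*k" for r t using A that SP_closed by simp
  then have row: "A r \<in> {..<2*k} \<rightarrow> carrier R" if "r < 2*k" for r using that by auto
  define f where "f = symp_form k w (A n)"
  define g where "g = symp_form k w v"
  have fg: "f \<in> carrier R" "g \<in> carrier R"
    unfolding f_def g_def using symp_form_closed w row[OF n] v(1) by auto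
  have "f \<ominus> g \<in> I n"
    unfolding f_def g_def using symp_form_diff_ideal[OF I[OF n] w row[OF n] v(1)] v(2) by blast
  \<comment> \<open>Row \<open>n\<close> is only congruent to \<open>v\<close>, so \<open>s\<close>,
    an inverse of \<open>g\<close> modulo \<open>I n\<close>, is transferred to
    \<open>f\<close>.\<close>
  then have "(f \<ominus> g) \<otimes> s \<oplus> (g \<otimes> s \<ominus> \<one>) \<in> I n"
    using s by (auto simp: g_def intro: In.I_r_closed)
  moreover have "(f \<ominus> g) \<otimes> s \<oplus> (g \<otimes> s \<ominus> \<one>) = f \<otimes> s \<ominus> \<one>" using fg s(1) by algebra
  ultimately have "(f \<otimes> s \<ominus> \<one>) \<otimes> e \<oplus> (e \<ominus> \<one>) \<in> I n"
    using e by (auto intro: In.I_r_closed)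
  moreover have "(f \<otimes> s \<ominus> \<one>) \<otimes> e \<oplus> (e \<ominus> \<one>) = f \<otimes> s \<otimes> e \<ominus> \<one>" using fg(1) s(1) e(1) by algebra
  ultimately have fse: "f \<otimes> s \<otimes> e \<ominus> \<one> \<in> I n" by simp
  define u where "u t = w t \<oplus> (\<ominus> \<one>) \<otimes> A n t" for t
  \<comment> \<open>The sign compensates for \<open>symp_form k (A n) u = \<ominus> f\<close>, shown
    below.\<close>
  define c where "c = \<ominus> (s \<otimes> e)"
  have u: "u \<in> {..<2*k} \<rightarrow> carrier R" using w row[OF n] by (auto simp: u_def Pi_iff)
  have cc: "c \<in> carrier R" using s e by (simp add: c_def)
  have "symp_form k (A n) u = symp_form k (A n) w \<oplus> (\<ominus> \<one>) \<otimes> symp_form k (A n) (A n)"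
    unfolding u_def using row[OF n] w by (intro symp_form_add_smult_right) auto
  then have fu: "symp_form k (A n) u = \<ominus> f"
    using symp_form_self[OF row[OF n]] symp_form_swap[OF w row[OF n]] fg(1) by (simp add: f_def)
  define B where "B = (\<lambda>r\<in>{..<2*k}. \<lambda>j\<in>{..<2*k}. A r j \<oplus> c \<otimes> symp_form k (A r) u \<otimes> u j)"
  have B: "B r j = A r j \<oplus> c \<otimes> symp_form k (A r) u \<otimes> u j" if "r < 2*k" "j < 2*k" for r j
    using that by (simp add: B_def)
  show ?thesis
  proof (intro bexI conjI allI impI)
    show "B \<in> SP R k" unfolding B_def by (rule SP_transvection[OF A u cc])
  next
    fix j assume j: "j < 2*k"
    have wj: "w j \<in> carrier R" "A n j \<in> carrier R" using w Ac n j by auto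
    \<comment> \<open>The distance of the new row from \<open>w\<close> is a multiple of
      \<open>f \<otimes> s \<otimes> e \<ominus> \<one>\<close>, which lies in
      \<open>I n\<close>.\<close>
    have "A n j \<oplus> (\<ominus> (s \<otimes> e)) \<otimes> (\<ominus> f) \<otimes> (w j \<oplus> (\<ominus> \<one>) \<otimes> A n j) \<ominus> w j
        = (f \<otimes> s \<otimes> e \<ominus> \<one>) \<otimes> (w j \<ominus> A n j)"
      using wj fg(1) s(1) e(1) by algebra
    then have "B n j \<ominus> w j = (f \<otimes> s \<otimes> e \<ominus> \<one>) \<otimes> (w j \<ominus> A n j)"
      using B[OF n j] fu by (simp add: u_def c_def)
    then show "B n j \<ominus> w j \<in> I n" using fse wj by (auto intro: In.I_r_closed)
  next
    fix i j assume i: "i < 2*k" "i \<noteq> n" and j: "j < 2*k"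
    interpret Ii: ideal "I i" R by (rule I[OF i(1)])
    have "c \<in> I i" unfolding c_def using e(3)[OF i] s by (auto intro: Ii.I_l_closed)
    moreover have fc: "symp_form k (A i) u \<in> carrier R" "u j \<in> carrier R"
      using symp_form_closed row[OF i(1)] u j by auto
    ultimately have "c \<otimes> symp_form k (A i) u \<otimes> u j \<in> I i" by (auto intro: Ii.I_r_closed)
    moreover have "A i j \<oplus> x \<ominus> A i j = x" if "x \<in> carrier R" for x
      using Ac[OF i(1) j] that by algebra
    ultimately show "B i j \<ominus> A i j \<in> I i" using B[OF i(1) j] fc cc by simp
  qed
qed

section \<open>Approximating prescribed rows and passing to classes\<close>

text \<open>The induction also records that rows from \<open>n\<close> on are still congruent to
  unit vectors, since \<open>SP_move_row\<close> must know the row it starts from.\<close>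

lemma SP_rows_approximation:
  assumes k: "k \<ge> 1" and I: "\<And>i. i < 2*k \<Longrightarrow> ideal (I i) R"
    and com: "\<And>i j. i < 2*k \<Longrightarrow> j < 2*k \<Longrightarrow> i \<noteq> j \<Longrightarrow> I i <+>\<^bsub>R\<^esub> I j = carrier R"
    and usc: "USC R (\<Otimes>\<^bsub>ideals_set R\<^esub>i\<in>{..<2*k}. I i) \<or>
         (\<Otimes>\<^bsub>ideals_set R\<^esub>i\<in>{..<2*k}. I i) = carrier R"
    and a: "\<And>i. i < 2*k \<Longrightarrow> a i \<in> {..<2*k} \<rightarrow> carrier R"
      "\<And>i. i < 2*k \<Longrightarrow> \<one> \<in> lincombs (a i) {..<2*k}"
    and "n \<le> 2*k"
  shows "\<exists>A\<in>SP R k. \<forall>i<2*k. \<forall>j<2*k.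
    A i j \<ominus> (if i < n then a i j else if i = j then \<one> else \<zero>) \<in> I i"
  using \<open>n \<le> 2*k\<close>
proof (induction n)
  case 0
  have "(if i = j then \<one> else \<zero>) \<ominus> (if i = j then \<one> else \<zero>) \<in> I i" if "i < 2*k" for i j
    using additive_subgroup.zero_closed[OF ideal.axioms(1)[OF I[OF that]]] by (simp add: minus_eq r_neg)
  then show ?case by (intro bexI[OF _ SP_one]) simp
next
  case (Suc n)
  then have n: "n < 2*k" by simp
  obtain A where A: "A \<in> SP R k" and Aapp: "\<And>i j. i < 2*k \<Longrightarrow> j < 2*k \<Longrightarrow>
      A i j \<ominus> (if i < n then a i j else if i = j then \<one> else \<zero>) \<in> I i"
    using Suc by auto
  obtain e where e: "e \<in> carrier R" "e \<ominus> \<one> \<in> I n"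
    and e_others: "\<And>i. i \<in> {..<2*k} - {n} \<Longrightarrow> e \<in> I i"
    using comaximal_separating_element[of "{..<2*k} - {n}" "I n" I] I com n by auto
  have e': "e \<in> I i" if "i < 2*k" "i \<noteq> n" for i using e_others that by simp
  \<comment> \<open>The coordinate paired with \<open>n\<close> by the form:
    \<open>z p = \<one>\<close> makes the pairing of \<open>z\<close> with the unit vector equal to
    1 or -1.\<close>
  define p where "p = (if n < k then n + k else n - k)"
  have p: "p < 2*k" using n by (auto simp: p_def)
  have k2: "2*k \<ge> 2" using k by simp
  \<comment> \<open>Taking the dual of \<open>a n\<close> as the unimodular tuple makes the
    resulting linear combination equal to \<open>symp_form k z (a n)\<close>.\<close>
  obtain z s where z: "z \<in> {..<2*k} \<rightarrow> carrier R" "z p = \<one>" and s: "s \<in> carrier R"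
    "(\<Oplus>l\<in>{..<2*k}. z l \<otimes> symp_dual k (a n) l) \<otimes> s \<ominus> \<one> \<in> (\<Otimes>\<^bsub>ideals_set R\<^esub>i\<in>{..<2*k}. I i)"
    using unital_set_condition_lincomb[OF usc k2 p symp_dual_closed[OF a(1)[OF n]] symp_dual_unimodular[OF a(1)[OF n] a(2)[OF n]]]
    by blast
  have s': "symp_form k z (a n) \<otimes> s \<ominus> \<one> \<in> I n"
    using s(2) finprod_ideals_set_subset[of "{..<2*k}" I n] I n symp_form_eq_dual[OF z(1) a(1)[OF n]] by auto
  let ?E = "\<lambda>t. if n = t then \<one> else \<zero>"
  \<comment> \<open>The value of \<open>symp_form k z ?E\<close>, which is its own inverse.\<close>
  define \<epsilon> where "\<epsilon> = (if n < k then \<ominus> \<one> else \<one>)"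
  have eps: "\<epsilon> \<in> carrier R" "\<epsilon> \<otimes> \<epsilon> = \<one>" by (auto simp: \<epsilon>_def l_minus)
  have E: "?E \<in> {..<2*k} \<rightarrow> carrier R" by auto
  have "symp_form k z ?E = \<ominus> symp_dual k z n"
    using symp_form_swap[OF E z(1)] symp_form_unit_vector[OF z(1) n] by simp
  also have "\<dots> = \<epsilon>" using z(2) by (auto simp: symp_dual_def p_def \<epsilon>_def split: if_splits)
  finally have form_E: "symp_form k z ?E \<otimes> \<epsilon> \<ominus> \<one> \<in> I n"
    using eps additive_subgroup.zero_closed[OF ideal.axioms(1)[OF I[OF n]]] by (simp add: minus_eq r_neg)
  have AE: "A n j \<ominus> ?E j \<in> I n" if "j < 2*k" for j using Aapp[OF n that] by simp
  from SP_move_row[of A k n I e ?E z \<epsilon>, OF A n I e e' E AE z(1) eps(1) form_E]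
  obtain B where B: "B \<in> SP R k" "\<forall>j<2*k. B n j \<ominus> z j \<in> I n"
    "\<forall>i<2*k. i \<noteq> n \<longrightarrow> (\<forall>j<2*k. B i j \<ominus> A i j \<in> I i)"
    by blast
  have Bz: "B n j \<ominus> z j \<in> I n" if "j < 2*k" for j using B(2) that by blast
  \<comment> \<open>The second move, from \<open>z\<close> to \<open>a n\<close>, has the arguments
    of the form in the other order, so the inverse changes sign.\<close>
  have "symp_form k (a n) z \<otimes> (\<ominus> s) \<ominus> \<one> = symp_form k z (a n) \<otimes> s \<ominus> \<one>"
    using symp_form_swap[OF z(1) a(1)[OF n]] symp_form_closed[OF z(1) a(1)[OF n]] s(1)
    by (simp add: l_minus r_minus)
  then have s2: "symp_form k (a n) z \<otimes> (\<ominus> s) \<ominus> \<one> \<in> I n" using s' by simp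
  from SP_move_row[of B k n I e z "a n" "\<ominus> s", OF B(1) n I e e' z(1) Bz a(1)[OF n] a_inv_closed[OF s(1)] s2]
  obtain C where C: "C \<in> SP R k" "\<forall>j<2*k. C n j \<ominus> a n j \<in> I n"
    "\<forall>i<2*k. i \<noteq> n \<longrightarrow> (\<forall>j<2*k. C i j \<ominus> B i j \<in> I i)"
    by blast
  have "C i j \<ominus> (if i < Suc n then a i j else if i = j then \<one> else \<zero>) \<in> I i"
    if i: "i < 2*k" and j: "j < 2*k" for i j
  proof (cases "i = n")
    case True
    then show ?thesis using C(2) j by simp
  next
    case False
    interpret Ii: ideal "I i" R by (rule I[OF i])
    let ?t = "if i < n then a i j else if i = j then \<one> else \<zero>"
    have cl: "A i j \<in> carrier R" "B i j \<in> carrier R" "C i j \<in> carrier R" "?t \<in> carrier R"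
      using SP_closed A B(1) C(1) i j a(1)[OF i] by auto
    have "C i j \<ominus> A i j \<in> I i"
      using Ii.diff_trans[of "C i j" "B i j" "A i j"] B(3) C(3) i j False cl by simp
    then have "C i j \<ominus> ?t \<in> I i"
      using Ii.diff_trans[OF _ Aapp[OF i j]] cl by simp
    moreover have "(i < Suc n) = (i < n)" using False by auto
    ultimately show ?thesis by simp
  qed
  then show ?case using C(1) by blast
qed

text \<open>The scalar 1 witnesses the equivalence, whatever the exponents.\<close>

lemma PF_class_eqI:
  assumes "ideal J R" "a \<in> GCD_tuples R (Suc n)" "b \<in> GCD_tuples R (Suc n)"
    "\<And>i. i \<le> n \<Longrightarrow> a i \<ominus> b i \<in> J"
  shows "PF_class R J n m a = PF_class R J n m b"
proof -
  interpret J: ideal J R by fact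
  interpret Q: cring "R Quot J" using J.quotient_is_cring is_cring by blast
  have "unit_mod R J \<one>" using Q.Units_one_closed by (simp add: unit_mod_def FactRing_def)
  moreover have "b i \<in> carrier R" if "i \<le> n" for i
    using assms(3) that by (auto simp: GCD_tuples_def PiE_def Pi_iff)
  ultimately have "(a, b) \<in> PF_rel R J n m"
    using assms(2-4) unfolding PF_rel_def by (auto intro!: exI[of _ \<one>])
  then show ?thesis unfolding PF_class_def by (rule equiv_class_eq[OF equiv_PF_rel[OF assms(1)]])
qed

end

theorem mainTheorem4:
  fixes R :: "('a, 'b) ring_scheme"
    and k :: nat
    and I :: "nat \<Rightarrow> 'a set"
    and m :: "nat \<Rightarrow> nat \<Rightarrow> nat"
  assumes "cring R"
    and "k \<ge> 1"
    and "\<And>i. i < 2*k \<Longrightarrow> ideal (I i) R"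
    and "\<And>i j. i < 2*k \<Longrightarrow> j < 2*k \<Longrightarrow> i \<noteq> j \<Longrightarrow> I i <+>\<^bsub>R\<^esub> I j = carrier R"
    and "USC R (\<Otimes>\<^bsub>ideals_set R\<^esub>i\<in>{..<2*k}. I i) \<or>
         (\<Otimes>\<^bsub>ideals_set R\<^esub>i\<in>{..<2*k}. I i) = carrier R"
  shows "SP_rows R k I m ` SP R k = (\<Pi>\<^sub>E i\<in>{..<2*k}. PF R (I i) (2*k - 1) (m i))"
proof (intro equalityI subsetI)
  interpret cring R by fact
  \<comment> \<open>\<open>PF\<close> with parameter \<open>2*k - 1\<close> consists of classes of
    tuples of length \<open>Suc (2*k - 1)\<close>; \<open>k \<ge> 1\<close> excludes truncated
    subtraction.\<close>
  have k: "Suc (2*k - 1) = 2*k" using assms(2) by simp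
  {
    fix F assume "F \<in> SP_rows R k I m ` SP R k"
    then obtain A where A: "A \<in> SP R k" "F = SP_rows R k I m A" by blast
    \<comment> \<open>This inclusion says that the map lands in the product: rows of symplectic
      matrices are unimodular.\<close>
    have "PF_class R (I i) (2*k - 1) (m i) (A i) \<in> PF R (I i) (2*k - 1) (m i)" if "i < 2*k" for i
      unfolding PF_class_def PF_def k using SP_row_GCD_tuple[OF A(1) that] by (rule quotientI)
    then show "F \<in> (\<Pi>\<^sub>E i\<in>{..<2*k}. PF R (I i) (2*k - 1) (m i))"
      unfolding A(2) SP_rows_def by auto
  next
    fix F assume F: "F \<in> (\<Pi>\<^sub>E i\<in>{..<2*k}. PF R (I i) (2*k - 1) (m i))"
    have "\<exists>b\<in>GCD_tuples R (2*k). F i = PF_class R (I i) (2*k - 1) (m i) b" if "i < 2*k" for i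
    proof -
      have "F i \<in> PF R (I i) (2*k - 1) (m i)" using F that by auto
      then show ?thesis unfolding PF_def PF_class_def k by (rule quotientE) blast
    qed
    then obtain a where a: "\<And>i. i < 2*k \<Longrightarrow> a i \<in> GCD_tuples R (2*k)"
      "\<And>i. i < 2*k \<Longrightarrow> F i = PF_class R (I i) (2*k - 1) (m i) (a i)" by metis
    have "a i \<in> {..<2*k} \<rightarrow> carrier R" "\<one>\<^bsub>R\<^esub> \<in> lincombs (a i) {..<2*k}" if "i < 2*k" for i
      using a(1)[OF that] by (auto simp: GCD_tuples_iff PiE_def)
    from SP_rows_approximation[of k I a "2*k", OF assms(2-5) this order_refl]
    obtain A where A: "A \<in> SP R k" "\<forall>i<2*k. \<forall>j<2*k. A i j \<ominus>\<^bsub>R\<^esub> a i j \<in> I i" by auto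
    have "PF_class R (I i) (2*k - 1) (m i) (A i) = F i" if i: "i < 2*k" for i
      unfolding a(2)[OF i]
    proof (rule PF_class_eqI[OF assms(3)[OF i]])
      fix j assume "j \<le> 2*k - 1"
      then show "A i j \<ominus>\<^bsub>R\<^esub> a i j \<in> I i" using A(2) i by auto
    qed (use a(1)[OF i] SP_row_GCD_tuple[OF A(1) i] k in auto)
    \<comment> \<open>Both functions are extensional, so agreement below \<open>2*k\<close> is
      enough.\<close>
    then have "SP_rows R k I m A = F"
      using F by (auto simp: SP_rows_def fun_eq_iff PiE_def extensional_def)
    then show "F \<in> SP_rows R k I m ` SP R k" using A(1) by blast
  }
qed

end
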